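(* Let $g$ be either the kernel of a BKF model with lacunary $(m_j)_{j\ge1}$, or the kernel of an attractive binary autoregressive model whose function $\phi$ is bi-Lipschitz on the interval $[-R,R]$, where $R=|\delta|+\sum_{n\ge1}|\beta_n|$. Then $g$ exhibits dynamic uniqueness if and only if $g$ satisfies the $\ell^2$ criterion, i.e. $\sum_{k=1}^\infty\mathrm{var}_k(g)^2<\infty$.
   Context: $S=\{-1,+1\}$, $\mathcal X=S^{\mathbb Z}$, $\mathcal X^-=S^{\{-1,-2,\dots\}}$. Sequences are written with the past to the right: $x_j^i=(x_i,\dots,x_j)$ for $j\le i$, $x_{-\infty}^i=(x_i,x_{i-1},\dots)$, $\underline x=x_{-\infty}^{-1}$; concatenations are read in the same order, sequences indexed by a left half-line of $\mathbb Z$ being identified by shifting indices. For $I\subset\mathbb R$, $\mathcal F_I$ is the $\sigma$-algebra on $\mathcal X$ generated by the coordinates with index in $I\cap\mathbb Z$; $\mathcal F=\mathcal F_{\mathbb R}$ and $\mathcal T^+=\bigcap_{n\ge1}\mathcal F_{[n,\infty)}$. A (probability) kernel $g$ on $S$ is a measurable function assigning to each $a\in S$, $\underline x\in\mathcal X^-$ a number $g(a\underline x)\in[0,1]$ with $\sum_{a\in S}g(a\underline x)=1$ for all $\underline x$. Its variation rate is $\mathrm{var}_k(g)=\sup_{a\in S}\sup_{\omega_{-k}^{-1}\in S^k}\sup_{\underline x,\underline y\in\mathcal X^-}|g(a\omega_{-k}^{-1}\underline x)-g(a\omega_{-k}^{-1}\underline y)|$. For $\underline x\in\mathcal X^-$,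 $P^{\underline x}$ is the probability measure on $(\mathcal X,\mathcal F)$, with canonical process $(X_j)_{j\in\mathbb Z}$, under which $X_{-\infty}^{-1}=\underline x$ almost surely and, for $j\ge0$, $P^{\underline x}[X_j=a\mid X_{-\infty}^{j-1}=y_{-\infty}^{j-1}]=g(ay_{-\infty}^{j-1})$. $g$ exhibits dynamic uniqueness if $P^{\underline x}[A]=P^{\underline y}[A]$ for all $A\in\mathcal T^+$ and all $\underline x,\underline y\in\mathcal X^-$. BKF (Bramson–Kalikow–Friedli) model: let $\varepsilon\in(0,1/2)$, let $(m_j)_{j\ge1}$ be an increasing sequence of positive odd numbers, let $(\lambda_j)_{j\ge1}$ be positive numbers with $\sum_j\lambda_j=1$, and let $\psi:[-1,1]\to[\varepsilon,1-\varepsilon]$ be non-decreasing with $\psi(r)+\psi(-r)=1$. The kernel is $g(a\underline x)=\sum_{j=1}^\infty\lambda_j\,\psi\Big(\frac{a}{m_j}\sum_{l=1}^{m_j}x_{-l}\Big)$. The sequence $(m_j)$ is lacunary if for some $0\le r_0<1$ such that $\psi(r_0)>\psi(-r_0)$ one has $m_{j+1}\ge\frac{4}{1-r_0}m_j$ for all $j\ge1$. Binary autoregressive model: let $\phi:\mathbb R\to(0,1)$ be continuous and increasing with $\phi(r)+\phi(-r)=1$, let $(\beta_n)_{n\ge1}$ be an absolutely summable sequence of real numbers, and $\delta\in\mathbb R$. The kernel is $g(a\underline x)=\phi\big(a\sum_{n\ge1}\beta_nx_{-n}+a\delta\big)$. It is attractive if all $\beta_n$ and $\delta$ are non-negative.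 A function is bi-Lipschitz on an interval if there is a constant $K\ge1$ such that $K^{-1}|r-s|\le|\phi(r)-\phi(s)|\le K|r-s|$ for all $r,s$ in it. *)

theory Defs
  imports "HOL-Probability.Probability"
begin

datatype spin = Minus | Plus

primrec spin_val :: "spin \<Rightarrow> real" where
  "spin_val Minus = -1"
| "spin_val Plus = 1"

lemma UNIV_spin: "(UNIV :: spin set) = {Minus, Plus}"
  using spin.exhaust by auto

instance spin :: finite
  by standard (simp add: UNIV_spin)

text \<open>
  A past \<open>(x\<^sub>-\<^sub>1, x\<^sub>-\<^sub>2, \<dots>)\<close> is coded, most recent symbol first, as the function
  \<open>x :: nat \<Rightarrow> spin\<close> whose value at \<open>l\<close> is the symbol with index \<open>- 1 - l\<close>. A finite word
  \<open>(w\<^sub>-\<^sub>1, \<dots>, w\<^sub>-\<^sub>k)\<close> is likewise the list with \<open>w ! l\<close> the symbol with index \<open>- 1 - l\<close>.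
\<close>

type_synonym past = "nat \<Rightarrow> spin"

type_synonym path = "int \<Rightarrow> spin"

definition concat_past :: "spin list \<Rightarrow> past \<Rightarrow> past" where
  "concat_past w x = (\<lambda>l. if l < length w then w ! l else x (l - length w))"

definition past_at :: "int \<Rightarrow> path \<Rightarrow> past" where
  "past_at j \<omega> = (\<lambda>l. \<omega> (j - 1 - int l))"

definition coord_algebra :: "int set \<Rightarrow> path measure" where
  "coord_algebra I = sigma UNIV {{\<omega>. \<omega> i = a} | i a. i \<in> I}"

definition tail_algebra :: "path set set" where
  "tail_algebra = (\<Inter>n\<in>{1..}. sets (coord_algebra {n..}))"

definition prob_kernel :: "(spin \<Rightarrow> past \<Rightarrow> real) \<Rightarrow> bool" where
  "prob_kernel g \<longleftrightarrow>
     (\<forall>a. g a \<in> borel_measurable (\<Pi>\<^sub>M l\<in>UNIV. count_space UNIV)) \<and>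
     (\<forall>a x. 0 \<le> g a x \<and> g a x \<le> 1) \<and>
     (\<forall>x. (\<Sum>a\<in>UNIV. g a x) = 1)"

definition variation :: "nat \<Rightarrow> (spin \<Rightarrow> past \<Rightarrow> real) \<Rightarrow> real" where
  "variation k g =
     Sup {\<bar>g a (concat_past w x) - g a (concat_past w y)\<bar> | a w x y. length w = k}"

definition l2_criterion :: "(spin \<Rightarrow> past \<Rightarrow> real) \<Rightarrow> bool" where
  "l2_criterion g \<longleftrightarrow> summable (\<lambda>k. (variation (Suc k) g)\<^sup>2)"

definition is_path_law :: "(spin \<Rightarrow> past \<Rightarrow> real) \<Rightarrow> past \<Rightarrow> path measure \<Rightarrow> bool" where
  "is_path_law g x P \<longleftrightarrow>
     prob_space P \<and> sets P = sets (coord_algebra UNIV) \<and>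
     (AE \<omega> in P. past_at 0 \<omega> = x) \<and>
     (\<forall>j\<ge>0. \<forall>a. AE \<omega> in P.
        real_cond_exp P (coord_algebra {..<j}) (indicator {\<omega>. \<omega> j = a}) \<omega> = g a (past_at j \<omega>))"

text \<open>The description is proper whenever \<open>g\<close> is a probability kernel, see \<open>ex1_path_law\<close> below.\<close>

definition path_law :: "(spin \<Rightarrow> past \<Rightarrow> real) \<Rightarrow> past \<Rightarrow> path measure" where
  "path_law g x = (THE P. is_path_law g x P)"

definition dynamic_uniqueness :: "(spin \<Rightarrow> past \<Rightarrow> real) \<Rightarrow> bool" where
  "dynamic_uniqueness g \<longleftrightarrow>
     (\<forall>A\<in>tail_algebra. \<forall>x y. measure (path_law g x) A = measure (path_law g y) A)"

text \<open>
  The sequences \<open>m\<close>, \<open>lam\<close> and \<open>beta\<close> below are indexed from \<open>1\<close>; their values at \<open>0\<close> play no role.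
\<close>

definition bkf_model :: "real \<Rightarrow> (nat \<Rightarrow> nat) \<Rightarrow> (nat \<Rightarrow> real) \<Rightarrow> (real \<Rightarrow> real) \<Rightarrow> bool" where
  "bkf_model eps m lam psi \<longleftrightarrow>
     0 < eps \<and> eps < 1 / 2 \<and>
     strict_mono_on {1..} m \<and> (\<forall>j\<ge>1. odd (m j)) \<and>
     (\<forall>j\<ge>1. 0 < lam j) \<and> (\<lambda>j. lam (Suc j)) sums 1 \<and>
     psi \<in> {-1..1} \<rightarrow> {eps..1 - eps} \<and> mono_on {-1..1} psi \<and>
     (\<forall>r\<in>{-1..1}. psi r + psi (- r) = 1)"

definition bkf_kernel ::
    "(nat \<Rightarrow> nat) \<Rightarrow> (nat \<Rightarrow> real) \<Rightarrow> (real \<Rightarrow> real) \<Rightarrow> spin \<Rightarrow> past \<Rightarrow> real" where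
  "bkf_kernel m lam psi a x =
     (\<Sum>j. lam (Suc j) *
        psi (spin_val a / real (m (Suc j)) * (\<Sum>l<m (Suc j). spin_val (x l))))"

definition lacunary :: "(nat \<Rightarrow> nat) \<Rightarrow> (real \<Rightarrow> real) \<Rightarrow> bool" where
  "lacunary m psi \<longleftrightarrow>
     (\<exists>r0. 0 \<le> r0 \<and> r0 < 1 \<and> psi (- r0) < psi r0 \<and>
        (\<forall>j\<ge>1. 4 / (1 - r0) * real (m j) \<le> real (m (Suc j))))"

definition autoreg_model :: "(real \<Rightarrow> real) \<Rightarrow> (nat \<Rightarrow> real) \<Rightarrow> bool" where
  "autoreg_model phi beta \<longleftrightarrow>
     range phi \<subseteq> {0<..<1} \<and> continuous_on UNIV phi \<and> strict_mono phi \<and>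
     (\<forall>r. phi r + phi (- r) = 1) \<and>
     summable (\<lambda>n. \<bar>beta (Suc n)\<bar>)"

definition autoreg_kernel ::
    "(real \<Rightarrow> real) \<Rightarrow> (nat \<Rightarrow> real) \<Rightarrow> real \<Rightarrow> spin \<Rightarrow> past \<Rightarrow> real" where
  "autoreg_kernel phi beta delta a x =
     phi (spin_val a * (\<Sum>n. beta (Suc n) * spin_val (x n)) + spin_val a * delta)"

definition attractive :: "(nat \<Rightarrow> real) \<Rightarrow> real \<Rightarrow> bool" where
  "attractive beta delta \<longleftrightarrow> (\<forall>n\<ge>1. 0 \<le> beta n) \<and> 0 \<le> delta"

definition autoreg_radius :: "(nat \<Rightarrow> real) \<Rightarrow> real \<Rightarrow> real" where
  "autoreg_radius beta delta = \<bar>delta\<bar> + (\<Sum>n. \<bar>beta (Suc n)\<bar>)"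

definition bi_lipschitz_on :: "real set \<Rightarrow> (real \<Rightarrow> real) \<Rightarrow> bool" where
  "bi_lipschitz_on I f \<longleftrightarrow>
     (\<exists>K\<ge>1. \<forall>r\<in>I. \<forall>s\<in>I. inverse K * \<bar>r - s\<bar> \<le> \<bar>f r - f s\<bar> \<and> \<bar>f r - f s\<bar> \<le> K * \<bar>r - s\<bar>)"

lemma measurable_past_coord [measurable]:
  "(\<lambda>x. spin_val (x l)) \<in> borel_measurable (\<Pi>\<^sub>M l\<in>(UNIV :: nat set). count_space UNIV)"
  by (rule measurable_compose[OF measurable_component_singleton[of l]]) auto

lemma abs_spin_val [simp]: "\<bar>spin_val a\<bar> = 1"
  by (cases a) auto

lemma prob_kernel_autoreg:
  assumes "autoreg_model phi beta"
  shows "prob_kernel (autoreg_kernel phi beta delta)"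
proof -
  have phi: "range phi \<subseteq> {0<..<1}" "continuous_on UNIV phi" "\<And>r. phi r + phi (- r) = 1"
    using assms by (auto simp: autoreg_model_def)
  have [measurable]: "phi \<in> borel_measurable borel"
    using phi(2) by (rule borel_measurable_continuous_onI)
  have "0 < phi r" "phi r < 1" for r
    using phi(1) by (auto simp: subset_iff)
  moreover have "(\<Sum>a\<in>UNIV. autoreg_kernel phi beta delta a x) = 1" for x
    using phi(3)[of "(\<Sum>n. beta (Suc n) * spin_val (x n)) + delta"]
    by (simp add: UNIV_spin autoreg_kernel_def algebra_simps)
  moreover have "autoreg_kernel phi beta delta a \<in> borel_measurable (\<Pi>\<^sub>M l\<in>UNIV. count_space UNIV)" for a
    unfolding autoreg_kernel_def[abs_def] by measurable
  ultimately show ?thesis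
    unfolding prob_kernel_def by (simp add: autoreg_kernel_def less_imp_le)
qed

lemma prob_kernel_bkf:
  assumes "bkf_model eps m lam psi"
  shows "prob_kernel (bkf_kernel m lam psi)"
proof -
  have psi: "psi \<in> {-1..1} \<rightarrow> {eps..1 - eps}" "mono_on {-1..1} psi"
    "\<And>r. r \<in> {-1..1} \<Longrightarrow> psi r + psi (- r) = 1" and eps: "0 < eps"
    and lam: "\<And>j. 0 < lam (Suc j)" "(\<lambda>j. lam (Suc j)) sums 1"
    and m: "\<And>j. odd (m (Suc j))"
    using assms by (auto simp: bkf_model_def)
  define r where "r j a x = spin_val a / real (m (Suc j)) * (\<Sum>l<m (Suc j). spin_val (x l))"
    for j a and x :: past
  have r: "r j a x \<in> {-1..1}" for j a x
  proof -
    have "\<bar>\<Sum>l<m (Suc j). spin_val (x l)\<bar> \<le> (\<Sum>l<m (Suc j). \<bar>spin_val (x l)\<bar>)"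
      by (rule sum_abs)
    also have "\<dots> = real (m (Suc j))"
      by simp
    finally have "\<bar>\<Sum>l<m (Suc j). spin_val (x l)\<bar> \<le> real (m (Suc j))" .
    moreover have "0 < m (Suc j)"
      using m[of j] by (auto intro: Nat.gr0I)
    ultimately have "\<bar>r j a x\<bar> \<le> 1"
      by (simp add: r_def abs_mult field_simps)
    then show ?thesis
      by (auto simp: abs_le_iff)
  qed
  have psi01: "0 \<le> psi (r j a x)" "psi (r j a x) \<le> 1" for j a x
    using funcset_mem[OF psi(1) r[of j a x]] eps by auto
  have eq: "bkf_kernel m lam psi = (\<lambda>a x. \<Sum>j. lam (Suc j) * psi (r j a x))"
    by (simp add: fun_eq_iff bkf_kernel_def r_def)
  have bound: "0 \<le> lam (Suc j) * psi (r j a x)" "lam (Suc j) * psi (r j a x) \<le> lam (Suc j)" for j a x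
    using psi01[of j a x] lam(1)[of j] by (auto intro: mult_left_le)
  have summ: "summable (\<lambda>j. lam (Suc j) * psi (r j a x))" for a x
    using bound by (intro summable_comparison_test'[OF sums_summable[OF lam(2)], of 0]) auto
  have "(\<Sum>j. lam (Suc j) * psi (r j a x)) \<le> 1" for a x
    using suminf_le[OF bound(2) summ sums_summable[OF lam(2)]] sums_unique[OF lam(2)] by simp
  moreover have "0 \<le> (\<Sum>j. lam (Suc j) * psi (r j a x))" for a x
    by (rule suminf_nonneg[OF summ bound(1)])
  moreover have "(\<Sum>a\<in>UNIV. \<Sum>j. lam (Suc j) * psi (r j a x)) = 1" for x
  proof -
    have "r j Minus x = - r j Plus x" for j
      by (simp add: r_def)
    then have "lam (Suc j) * psi (r j Plus x) + lam (Suc j) * psi (r j Minus x) = lam (Suc j)" for j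
      using psi(3)[OF r[of j Plus x]] by (simp add: distrib_left[symmetric])
    then show ?thesis
      using sums_unique[OF lam(2)]
      by (simp add: UNIV_spin suminf_add[OF summ summ] add.commute)
  qed
  moreover have "(\<lambda>x. \<Sum>j. lam (Suc j) * psi (r j a x)) \<in>
      borel_measurable (\<Pi>\<^sub>M l\<in>UNIV. count_space UNIV)" for a
  proof -
    have psi_meas: "psi \<in> borel_measurable (restrict_space borel {-1..1})"
      using psi(2) by (intro borel_measurable_mono_on_fnc)
    have "(\<lambda>x. r j a x) \<in> borel_measurable (\<Pi>\<^sub>M l\<in>UNIV. count_space UNIV)" for j
      unfolding r_def by measurable
    then have "(\<lambda>x. r j a x) \<in> measurable (\<Pi>\<^sub>M l\<in>UNIV. count_space UNIV) (restrict_space borel {-1..1})" for j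
      using r by (intro measurable_restrict_space2) auto
    then have [measurable]: "(\<lambda>x. psi (r j a x)) \<in> borel_measurable (\<Pi>\<^sub>M l\<in>UNIV. count_space UNIV)" for j
      by (rule measurable_compose[OF _ psi_meas])
    show ?thesis
      by measurable
  qed
  ultimately show ?thesis
    unfolding prob_kernel_def eq by auto
qed

lemma space_coord_algebra [simp]: "space (coord_algebra I) = UNIV"
  by (simp add: coord_algebra_def)

lemma sets_coord_algebra:
  "sets (coord_algebra I) = sigma_sets UNIV {{\<omega>. \<omega> i = a} | i a. i \<in> I}"
  unfolding coord_algebra_def by (rule sets_measure_of) auto

lemma measurable_coord:
  assumes "i \<in> I"
  shows "(\<lambda>\<omega>. \<omega> i) \<in> measurable (coord_algebra I) (count_space UNIV)"
proof -
  have "{\<omega>. \<omega> i = a} \<in> sets (coord_algebra I)" for a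
    using assms unfolding sets_coord_algebra by blast
  then show ?thesis
    by (auto simp: measurable_count_space_eq2 vimage_def)
qed

lemma measurable_into_coord_algebra:
  fixes f :: "'a \<Rightarrow> path"
  assumes "\<And>i. i \<in> I \<Longrightarrow> (\<lambda>\<omega>. f \<omega> i) \<in> measurable N (count_space UNIV)"
  shows "f \<in> measurable N (coord_algebra I)"
proof (rule measurable_sigma_sets[OF sets_coord_algebra])
  fix y :: "path set" assume "y \<in> {{\<omega>. \<omega> i = a} | i a. i \<in> I}"
  then obtain i a where i: "i \<in> I" and y: "y = {\<omega>. \<omega> i = a}"
    by blast
  have "(\<lambda>\<omega>. f \<omega> i) -` {a} \<inter> space N \<in> sets N"
    using assms[OF i] by (rule measurable_sets) simp
  then show "f -` y \<inter> space N \<in> sets N"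
    by (simp add: y vimage_def)
qed auto

lemma coord_algebra_mono:
  assumes "I \<subseteq> J"
  shows "sets (coord_algebra I) \<subseteq> sets (coord_algebra J)"
  unfolding sets_coord_algebra using assms by (intro sigma_sets_mono') blast

lemma coord_algebra_cong:
  assumes "A \<in> sets (coord_algebra I)" and "\<And>i. i \<in> I \<Longrightarrow> \<omega> i = \<omega>' i"
  shows "\<omega> \<in> A \<longleftrightarrow> \<omega>' \<in> A"
  using assms(1) unfolding sets_coord_algebra
proof induction
  case (Basic B)
  then show ?case using assms(2) by auto
qed auto

lemma measurable_past_at:
  "past_at j \<in> measurable (coord_algebra {..<j}) (\<Pi>\<^sub>M l\<in>UNIV. count_space UNIV)"
  unfolding past_at_def
  by (rule measurable_PiM_single') (auto intro!: measurable_coord)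

lemma measurable_kernel_past_at:
  assumes "prob_kernel g"
  shows "(\<lambda>\<omega>. g a (past_at j \<omega>)) \<in> borel_measurable (coord_algebra {..<j})"
  using assms unfolding prob_kernel_def
  by (intro measurable_compose[OF measurable_past_at]) auto

lemma subalgebra_coord_algebra:
  assumes "sets P = sets (coord_algebra UNIV)"
  shows "subalgebra P (coord_algebra I)"
  using assms coord_algebra_mono[of I UNIV] sets_eq_imp_space_eq[OF assms]
  by (auto simp: subalgebra_def)

lemma coord_event:
  assumes "i \<in> I"
  shows "{\<omega>. \<omega> i = a} \<in> sets (coord_algebra I)"
  using assms unfolding sets_coord_algebra by blast

lemma path_law_iff_step:
  assumes g: "prob_kernel g" and "prob_space P" and sets: "sets P = sets (coord_algebra UNIV)"
  shows "(AE \<omega> in P. real_cond_exp P (coord_algebra {..<j}) (indicator {\<omega>. \<omega> j = a}) \<omega> =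
            g a (past_at j \<omega>)) \<longleftrightarrow>
    (\<forall>A\<in>sets (coord_algebra {..<j}).
       measure P (A \<inter> {\<omega>. \<omega> j = a}) = (\<integral>\<omega>. indicator A \<omega> * g a (past_at j \<omega>) \<partial>P))"
    (is "?L \<longleftrightarrow> ?R")
proof -
  interpret prob_space P by fact
  let ?F = "coord_algebra {..<j}"
  have sub: "subalgebra P ?F"
    using sets by (rule subalgebra_coord_algebra)
  interpret finite_measure_subalgebra P ?F
    by standard (rule sub)
  have space: "space P = UNIV"
    using sets_eq_imp_space_eq[OF sets] by simp
  have ev: "{\<omega>. \<omega> j = a} \<in> sets P"
    unfolding sets by (rule coord_event) simp
  have inP: "A \<in> sets P" if "A \<in> sets ?F" for A
    using that sub by (auto simp: subalgebra_def)
  have int: "integrable P (indicator {\<omega>. \<omega> j = a} :: _ \<Rightarrow> real)"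
    using ev by (simp add: integrable_real_indicator emeasure_eq_measure)
  have gF: "(\<lambda>\<omega>. g a (past_at j \<omega>)) \<in> borel_measurable ?F"
    using g by (rule measurable_kernel_past_at)
  have gP: "(\<lambda>\<omega>. g a (past_at j \<omega>)) \<in> borel_measurable P"
    by (rule measurable_from_subalg[OF sub gF])
  have gint: "integrable P (\<lambda>\<omega>. g a (past_at j \<omega>))"
    using g by (intro integrable_const_bound[where B=1] gP) (auto simp: prob_kernel_def)
  have eq: "(\<integral>\<omega>\<in>A. indicator {\<omega>. \<omega> j = a} \<omega> \<partial>P) = measure P (A \<inter> {\<omega>. \<omega> j = a})" 
    if "A \<in> sets ?F" for A
    using space by (simp add: set_lebesgue_integral_def indicator_inter_arith[symmetric])
  show ?thesis
  proof
    assume ?R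
    then show ?L
      using eq by (intro real_cond_exp_charact int gint gF) (simp add: set_lebesgue_integral_def)
  next
    assume L: ?L
    show ?R
    proof
      fix A assume A: "A \<in> sets ?F"
      have "measure P (A \<inter> {\<omega>. \<omega> j = a}) =
          (\<integral>\<omega>\<in>A. real_cond_exp P ?F (indicator {\<omega>. \<omega> j = a}) \<omega> \<partial>P)"
        using real_cond_exp_intA[OF int A] eq[OF A] by simp
      also have "\<dots> = (\<integral>\<omega>\<in>A. g a (past_at j \<omega>) \<partial>P)"
        using L inP[OF A] gP
        by (intro set_lebesgue_integral_cong_AE) (auto intro: borel_measurable_cond_exp2)
      finally show "measure P (A \<inter> {\<omega>. \<omega> j = a}) = (\<integral>\<omega>. indicator A \<omega> * g a (past_at j \<omega>) \<partial>P)"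
        by (simp add: set_lebesgue_integral_def)
    qed
  qed
qed

lemma path_law_agree:
  assumes g: "prob_kernel g" and P: "is_path_law g x P" and Q: "is_path_law g x Q"
    and A: "A \<in> sets (coord_algebra {..<int n})"
  shows "measure P A = measure Q A"
  using A
proof (induction n arbitrary: A)
  case 0
  define \<omega>0 :: path where "\<omega>0 = (\<lambda>i. x (nat (- 1 - i)))"
  have *: "measure R A = of_bool (\<omega>0 \<in> A)" if R: "is_path_law g x R" for R
  proof -
    interpret prob_space R
      using R by (simp add: is_path_law_def)
    have sets: "sets R = sets (coord_algebra UNIV)"
      using R by (simp add: is_path_law_def)
    have A: "A \<in> sets R"
      using 0 coord_algebra_mono[of "{..<int 0}" UNIV] unfolding sets by auto
    have "AE \<omega> in R. past_at 0 \<omega> = x"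
      using R by (simp add: is_path_law_def)
    then have AE: "AE \<omega> in R. \<omega> \<in> A \<longleftrightarrow> \<omega>0 \<in> A"
    proof (rule AE_mp[OF _ AE_I2], intro impI)
      fix \<omega> assume "past_at 0 \<omega> = x"
      then have "\<omega> i = \<omega>0 i" if "i \<in> {..<int 0}" for i
        using that unfolding \<omega>0_def by (auto simp: past_at_def)
      then show "\<omega> \<in> A \<longleftrightarrow> \<omega>0 \<in> A"
        by (rule coord_algebra_cong[OF 0])
    qed
    show ?thesis
    proof (cases "\<omega>0 \<in> A")
      case True
      with AE A show ?thesis by (simp add: prob_eq_1)
    next
      case False
      with AE A show ?thesis by (simp add: prob_eq_0)
    qed
  qed
  show ?case
    using *[OF P] *[OF Q] by simp
next
  case (Suc n)
  let ?F = "coord_algebra {..<int n}"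
  have PQ: "prob_space P" "prob_space Q" and sets: "sets P = sets (coord_algebra UNIV)"
    "sets Q = sets (coord_algebra UNIV)"
    using P Q by (auto simp: is_path_law_def)
  have sub: "subalgebra P ?F" "subalgebra Q ?F"
    using sets by (auto intro: subalgebra_coord_algebra)
  interpret P: prob_space P by fact
  interpret Q: prob_space Q by fact
  have restr: "restr_to_subalg P ?F = restr_to_subalg Q ?F"
  proof (rule measure_eqI)
    fix B assume "B \<in> sets (restr_to_subalg P ?F)"
    then have B: "B \<in> sets ?F"
      by (simp add: sets_restr_to_subalg[OF sub(1)])
    show "emeasure (restr_to_subalg P ?F) B = emeasure (restr_to_subalg Q ?F) B"
      using Suc.IH[OF B]
      by (simp add: emeasure_restr_to_subalg[OF sub(1) B] emeasure_restr_to_subalg[OF sub(2) B]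
          P.emeasure_eq_measure Q.emeasure_eq_measure)
  qed (simp add: sets_restr_to_subalg[OF sub(1)] sets_restr_to_subalg[OF sub(2)])
  have "measure P (A \<inter> {\<omega>. \<omega> (int n) = a}) = measure Q (A \<inter> {\<omega>. \<omega> (int n) = a})" for a
  proof -
    define B where "B = {\<omega>. fun_upd \<omega> (int n) a \<in> A}"
    have "(\<lambda>\<omega>. fun_upd \<omega> (int n) a) \<in> measurable ?F (coord_algebra {..<int (Suc n)})"
    proof (rule measurable_into_coord_algebra)
      fix i assume "i \<in> {..<int (Suc n)}"
      then show "(\<lambda>\<omega>. fun_upd \<omega> (int n) a i) \<in> measurable ?F (count_space UNIV)"
        by (cases "i = int n") (auto intro: measurable_coord)
    qed
    from measurable_sets[OF this Suc.prems] have B: "B \<in> sets ?F"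
      by (simp add: B_def vimage_def)
    have eq: "A \<inter> {\<omega>. \<omega> (int n) = a} = B \<inter> {\<omega>. \<omega> (int n) = a}"
    proof -
      have "fun_upd \<omega> (int n) a = \<omega>" if "\<omega> (int n) = a" for \<omega> :: path
        using that by auto
      then show ?thesis
        by (auto simp: B_def)
    qed
    have meas: "(\<lambda>\<omega>. indicator B \<omega> * g a (past_at (int n) \<omega>)) \<in> borel_measurable ?F"
      using B measurable_kernel_past_at[OF g] by (intro borel_measurable_times) auto
    have R: "measure R (B \<inter> {\<omega>. \<omega> (int n) = a}) =
        (\<integral>\<omega>. indicator B \<omega> * g a (past_at (int n) \<omega>) \<partial>R)" if "is_path_law g x R" for R
    proof -
      have "prob_space R" "sets R = sets (coord_algebra UNIV)"
        "AE \<omega> in R. real_cond_exp R ?F (indicator {\<omega>. \<omega> (int n) = a}) \<omega> = g a (past_at (int n) \<omega>)"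
        using that by (auto simp: is_path_law_def)
      then show ?thesis
        using path_law_iff_step[OF g, of R "int n" a] B by blast
    qed
    show ?thesis
      using integral_subalgebra2[OF sub(1) meas] integral_subalgebra2[OF sub(2) meas]
      unfolding eq R[OF P] R[OF Q] by (simp add: restr)
  qed
  note step = this
  have A: "A \<in> sets (coord_algebra UNIV)"
    using Suc.prems coord_algebra_mono[of "{..<int (Suc n)}" UNIV] by auto
  have split: "measure R A =
      measure R (A \<inter> {\<omega>. \<omega> (int n) = Plus}) + measure R (A \<inter> {\<omega>. \<omega> (int n) = Minus})"
    if "prob_space R" "sets R = sets (coord_algebra UNIV)" for R
  proof -
    interpret prob_space R by fact
    have ev: "A \<inter> {\<omega>. \<omega> (int n) = a} \<in> sets R" for a
      unfolding that(2) using A coord_event[of "int n" UNIV a] by auto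
    have "A = (A \<inter> {\<omega>. \<omega> (int n) = Plus}) \<union> (A \<inter> {\<omega>. \<omega> (int n) = Minus})"
      using spin.exhaust by auto
    moreover have disj: "A \<inter> {\<omega>. \<omega> (int n) = Plus} \<inter> (A \<inter> {\<omega>. \<omega> (int n) = Minus}) = {}"
      by auto
    ultimately show ?thesis
      using finite_measure_Union[OF ev ev, of Plus Minus] by (metis (mono_tags, lifting) disj)
  qed
  show ?case
    using split[OF PQ(1) sets(1)] split[OF PQ(2) sets(2)] step by simp
qed

lemma path_law_unique:
  assumes g: "prob_kernel g" and P: "is_path_law g x P" and Q: "is_path_law g x Q"
  shows "P = Q"
proof -
  define E where "E = (\<Union>n. sets (coord_algebra {..<int n}))"
  interpret P: prob_space P
    using P by (simp add: is_path_law_def)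
  interpret Q: prob_space Q
    using Q by (simp add: is_path_law_def)
  have gen: "sets (coord_algebra UNIV) = sigma_sets UNIV E"
  proof
    have "{{\<omega> :: path. \<omega> i = a} | i a. i \<in> UNIV} \<subseteq> E"
    proof
      fix y assume "y \<in> {{\<omega> :: path. \<omega> i = a} | i a. i \<in> UNIV}"
      then obtain i a where y: "y = {\<omega> :: path. \<omega> i = a}"
        by blast
      have "y \<in> sets (coord_algebra {..<int (nat (i + 1))})"
        unfolding y by (rule coord_event) auto
      then show "y \<in> E"
        unfolding E_def by blast
    qed
    then show "sets (coord_algebra UNIV) \<subseteq> sigma_sets UNIV E"
      unfolding sets_coord_algebra by (rule sigma_sets_mono')
    have "E \<subseteq> sets (coord_algebra UNIV)"
      unfolding E_def using coord_algebra_mono by blast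
    then show "sigma_sets UNIV E \<subseteq> sets (coord_algebra UNIV)"
      using sets.sigma_sets_subset[of E "coord_algebra UNIV"] by simp
  qed
  show ?thesis
  proof (rule measure_eqI_generator_eq[where \<Omega>=UNIV and E=E and A="\<lambda>_. UNIV"])
    show "Int_stable E"
    proof (rule Int_stableI)
      fix A B assume "A \<in> E" "B \<in> E"
      then obtain k l where "A \<in> sets (coord_algebra {..<int k})" "B \<in> sets (coord_algebra {..<int l})"
        unfolding E_def by blast
      then have "A \<in> sets (coord_algebra {..<int (max k l)})" "B \<in> sets (coord_algebra {..<int (max k l)})"
        using coord_algebra_mono[of "{..<int k}" "{..<int (max k l)}"]
          coord_algebra_mono[of "{..<int l}" "{..<int (max k l)}"] by auto
      then have "A \<inter> B \<in> sets (coord_algebra {..<int (max k l)})"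
        by (rule sets.Int)
      then show "A \<inter> B \<in> E"
        unfolding E_def by blast
    qed
    show "emeasure P X = emeasure Q X" if "X \<in> E" for X
      using that path_law_agree[OF g P Q]
      by (auto simp: E_def P.emeasure_eq_measure Q.emeasure_eq_measure)
    show "sets P = sigma_sets UNIV E" "sets Q = sigma_sets UNIV E"
      using P Q gen by (auto simp: is_path_law_def)
    show "range (\<lambda>_. UNIV) \<subseteq> E"
      using sets.top[of "coord_algebra _"] by (auto simp: E_def)
  qed auto
qed

context
  fixes g :: "spin \<Rightarrow> past \<Rightarrow> real" and x :: past
  assumes g: "prob_kernel g"
begin

definition glue :: "(nat \<Rightarrow> spin) \<Rightarrow> path" where
  "glue s = (\<lambda>i. if i < 0 then x (nat (- 1 - i)) else s (nat i))"

definition next_symbol :: "nat \<Rightarrow> (nat \<Rightarrow> spin) \<Rightarrow> spin measure" where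
  "next_symbol n s = measure_pmf (map_pmf (\<lambda>b. if b then Plus else Minus)
     (bernoulli_pmf (g Plus (past_at (int n) (glue s)))))"

lemma kernel_bounds: "0 \<le> g a y" "g a y \<le> 1" "g Minus y = 1 - g Plus y"
  using g by (auto simp: prob_kernel_def UNIV_spin algebra_simps)

lemma emeasure_next_symbol:
  "emeasure (next_symbol n s) {a} = ennreal (g a (past_at (int n) (glue s)))"
proof -
  let ?p = "g Plus (past_at (int n) (glue s))"
  have vim: "(\<lambda>b. if b then Plus else Minus) -` {a} = {a = Plus}"
    by (cases a) (auto split: if_splits)
  have "pmf (map_pmf (\<lambda>b. if b then Plus else Minus) (bernoulli_pmf ?p)) a =
      pmf (bernoulli_pmf ?p) (a = Plus)"
    unfolding pmf_map vim by (simp add: measure_pmf_single)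
  also have "\<dots> = g a (past_at (int n) (glue s))"
    using kernel_bounds by (cases a) auto
  finally show ?thesis
    by (simp add: next_symbol_def emeasure_pmf_single)
qed

lemma PiM_spin: "PiM {0..<n :: nat} (\<lambda>_. count_space (UNIV :: spin set)) =
    count_space (PiE {0..<n} (\<lambda>_. UNIV))"
  by (rule count_space_PiM_finite) auto

lemma Ionescu_Tulcea_next_symbol: "Ionescu_Tulcea next_symbol (\<lambda>_. count_space UNIV)"
proof (rule Ionescu_Tulcea.intro)
  show "next_symbol i \<in> measurable (PiM {0..<i} (\<lambda>_. count_space UNIV)) (subprob_algebra (count_space UNIV))"
    for i
    unfolding PiM_spin next_symbol_def
    by (auto simp: measurable_count_space_eq1 measure_pmf_in_subprob_algebra)
  show "prob_space (next_symbol i s)"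
    if "s \<in> space (PiM {0..<i} (\<lambda>_. count_space UNIV))" for i s
    unfolding next_symbol_def by (rule prob_space_measure_pmf)
qed

interpretation IT: Ionescu_Tulcea next_symbol "\<lambda>_. count_space UNIV"
  by (rule Ionescu_Tulcea_next_symbol)

lemma nn_integral_lim:
  fixes f :: "(nat \<Rightarrow> spin) \<Rightarrow> ennreal"
  shows "(\<integral>\<^sup>+s. f (restrict s {0..<n}) \<partial>IT.PF.lim) = (\<integral>\<^sup>+s. f s \<partial>IT.C 0 n (\<lambda>_. undefined))"
proof -
  let ?M = "PiM {0..<n} (\<lambda>_. count_space (UNIV :: spin set))"
  have sp: "(\<lambda>_. undefined) \<in> space (PiM {0..<0 :: nat} (\<lambda>_. count_space (UNIV :: spin set)))"
    by (simp add: space_PiM)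
  have C: "sets (IT.C 0 n (\<lambda>_. undefined)) = sets ?M"
    using IT.sets_C[OF sp, of n] by simp
  have CI: "IT.CI {0..<n} = IT.C 0 n (\<lambda>_. undefined)"
  proof (rule measure_eqI)
    fix X assume "X \<in> sets (IT.CI {0..<n})"
    then have X: "X \<in> sets ?M"
      by (simp add: IT.CI_def)
    have "prod_emb {0..<n} (\<lambda>_. count_space UNIV) {0..<n} X = X"
      using sets.sets_into_space[OF X] by (intro prod_emb_id) (simp add: space_PiM)
    then show "emeasure (IT.CI {0..<n}) X = emeasure (IT.C 0 n (\<lambda>_. undefined)) X"
      using IT.emeasure_CI[OF order_refl X] by simp
  qed (simp add: IT.CI_def C)
  have f: "f \<in> borel_measurable ?M"
    by (simp add: PiM_spin)
  have "(\<integral>\<^sup>+s. f s \<partial>IT.C 0 n (\<lambda>_. undefined)) =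
      (\<integral>\<^sup>+s. f s \<partial>distr IT.PF.lim ?M (\<lambda>s. restrict s {0..<n}))"
    using IT.distr_lim[of "{0..<n}"] CI by simp
  also have "\<dots> = (\<integral>\<^sup>+s. f (restrict s {0..<n}) \<partial>IT.PF.lim)"
    using f by (intro nn_integral_distr)
      (auto simp: measurable_cong_sets[OF IT.PF.sets_lim refl] intro!: measurable_restrict_subset)
  finally show ?thesis ..
qed

lemma nn_integral_lim_Suc:
  fixes h :: "(nat \<Rightarrow> spin) \<Rightarrow> ennreal"
  assumes h: "\<And>s b. h (s(n := b)) = h s" "\<And>s. h (restrict s {0..<n}) = h s"
  shows "(\<integral>\<^sup>+s. h s * indicator {s. s n = a} s \<partial>IT.PF.lim) =
    (\<integral>\<^sup>+s. h s * ennreal (g a (past_at (int n) (glue s))) \<partial>IT.PF.lim)"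
proof -
  let ?C = "\<lambda>n. IT.C 0 n (\<lambda>_. undefined)"
  let ?M = "\<lambda>n. PiM {0..<n :: nat} (\<lambda>_. count_space (UNIV :: spin set))"
  let ?f = "\<lambda>s. h s * indicator {s. s n = a} s"
  have sp: "(\<lambda>_. undefined) \<in> space (?M 0)"
    by (simp add: space_PiM)
  have C: "sets (?C n) = sets (?M n)"
    using IT.sets_C[OF sp, of n] by simp
  have hS: "h (restrict s {0..<Suc n}) = h s" for s
  proof -
    have "restrict (restrict s {0..<Suc n}) {0..<n} = restrict s {0..<n}"
      by (simp add: restrict_restrict)
    then show ?thesis
      using h(2) by metis
  qed
  have f: "?f \<in> borel_measurable (?M (Suc n))"
    unfolding PiM_spin by (rule measurable_count_space_eq1[THEN iffD2]) auto
  have glue: "past_at (int n) (glue (restrict s {0..<n})) = past_at (int n) (glue s)" for s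
    by (auto simp: past_at_def glue_def fun_eq_iff)
  have "(\<integral>\<^sup>+s. ?f s \<partial>IT.PF.lim) = (\<integral>\<^sup>+s. ?f (restrict s {0..<Suc n}) \<partial>IT.PF.lim)"
    by (simp add: hS indicator_def)
  also have "\<dots> = (\<integral>\<^sup>+s. ?f s \<partial>?C (Suc n))"
    by (rule nn_integral_lim)
  also have "\<dots> = (\<integral>\<^sup>+s. \<integral>\<^sup>+t. ?f t \<partial>IT.eP n s \<partial>?C n)"
    using IT.measurable_eP[of n]
    by (simp add: nn_integral_bind[OF f] measurable_cong_sets[OF C refl])
  also have "\<dots> = (\<integral>\<^sup>+s. h s * ennreal (g a (past_at (int n) (glue s))) \<partial>?C n)"
  proof (rule nn_integral_cong)
    fix s assume "s \<in> space (?C n)"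
    then have s: "s \<in> space (?M n)"
      using sets_eq_imp_space_eq[OF C] by simp
    have "(\<integral>\<^sup>+t. ?f t \<partial>IT.eP n s) = (\<integral>\<^sup>+b. ?f (s(n := b)) \<partial>next_symbol n s)"
      using s f by (rule IT.nn_integral_eP)
    also have "\<dots> = (\<integral>\<^sup>+b. h s * indicator {a} b \<partial>next_symbol n s)"
      by (intro nn_integral_cong) (simp add: h(1) indicator_def)
    also have "\<dots> = h s * emeasure (next_symbol n s) {a}"
      by (rule nn_integral_cmult_indicator) (simp add: next_symbol_def)
    finally show "(\<integral>\<^sup>+t. ?f t \<partial>IT.eP n s) = h s * ennreal (g a (past_at (int n) (glue s)))"
      by (simp add: emeasure_next_symbol)
  qed
  also have "\<dots> = (\<integral>\<^sup>+s. h (restrict s {0..<n}) *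
      ennreal (g a (past_at (int n) (glue (restrict s {0..<n})))) \<partial>IT.PF.lim)"
    by (rule nn_integral_lim[symmetric])
  also have "\<dots> = (\<integral>\<^sup>+s. h s * ennreal (g a (past_at (int n) (glue s))) \<partial>IT.PF.lim)"
    by (simp add: h(2) glue)
  finally show ?thesis .
qed

lemma path_law_exists: "\<exists>P. is_path_law g x P"
proof
  let ?P = "distr IT.PF.lim (coord_algebra UNIV) glue"
  have glue: "glue \<in> measurable IT.PF.lim (coord_algebra UNIV)"
  proof (rule measurable_into_coord_algebra)
    fix i :: int
    have "(\<lambda>s. s (nat i)) \<in> measurable IT.PF.lim (count_space UNIV)"
      using measurable_component_singleton[of "nat i" UNIV "\<lambda>_. count_space UNIV"]
      by (simp add: measurable_cong_sets[OF IT.PF.sets_lim refl])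
    then show "(\<lambda>s. glue s i) \<in> measurable IT.PF.lim (count_space UNIV)"
      by (cases "i < 0") (auto simp: glue_def)
  qed
  have prob_lim: "prob_space IT.PF.lim"
  proof (rule prob_space_distrD)
    show "(\<lambda>s. restrict s {}) \<in> measurable IT.PF.lim (PiM {} (\<lambda>_. count_space UNIV))"
      by (auto simp: measurable_cong_sets[OF IT.PF.sets_lim refl] intro!: measurable_restrict_subset)
    show "prob_space (distr IT.PF.lim (PiM {} (\<lambda>_. count_space UNIV)) (\<lambda>s. restrict s {}))"
      using IT.PF.prob_space_P[of "{}"] by (subst IT.distr_lim) auto
  qed
  interpret P: prob_space ?P
    using prob_lim glue by (rule prob_space.prob_space_distr)
  have past: "AE \<omega> in ?P. past_at 0 \<omega> = x"
  proof -
    have "past_at 0 \<in> measurable (coord_algebra UNIV) (\<Pi>\<^sub>M l\<in>UNIV. count_space UNIV)"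
      unfolding past_at_def by (rule measurable_PiM_single') (auto intro!: measurable_coord)
    then have "{\<omega> \<in> space (coord_algebra UNIV). past_at 0 \<omega> = x} \<in> sets (coord_algebra UNIV)"
      unfolding fun_eq_iff past_at_def
      by (intro sets.sets_Collect_countable_All) (auto intro!: coord_event)
    then show ?thesis
      by (subst AE_distr_iff[OF glue]) (auto simp: past_at_def glue_def fun_eq_iff)
  qed
  have step: "measure ?P (A \<inter> {\<omega>. \<omega> j = a}) = (\<integral>\<omega>. indicator A \<omega> * g a (past_at j \<omega>) \<partial>?P)"
    if j: "0 \<le> j" and A: "A \<in> sets (coord_algebra {..<j})" for j a A
  proof -
    define n where "n = nat j"
    have n: "j = int n"
      using j by (simp add: n_def)
    have AU: "A \<in> sets (coord_algebra UNIV)"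
      using A coord_algebra_mono[of "{..<j}" UNIV] by auto
    have ev: "A \<inter> {\<omega>. \<omega> j = a} \<in> sets (coord_algebra UNIV)"
      using AU coord_event[of j UNIV a] by auto
    have gm: "(\<lambda>\<omega>. g a (past_at j \<omega>)) \<in> borel_measurable (coord_algebra UNIV)"
      using measurable_kernel_past_at[OF g, of a j] coord_algebra_mono[of "{..<j}" UNIV]
      by (auto simp: measurable_def)
    have m: "(\<lambda>\<omega>. indicator A \<omega> * g a (past_at j \<omega>)) \<in> borel_measurable (coord_algebra UNIV)"
      using AU gm by (intro borel_measurable_times) auto
    define h :: "(nat \<Rightarrow> spin) \<Rightarrow> ennreal" where "h s = indicator A (glue s)" for s
    have h: "h (s(n := b)) = h s" "h (restrict s {0..<n}) = h s" for s b
    proof -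
      have "glue (s(n := b)) \<in> A \<longleftrightarrow> glue s \<in> A" "glue (restrict s {0..<n}) \<in> A \<longleftrightarrow> glue s \<in> A"
        by (rule coord_algebra_cong[OF A]; auto simp: glue_def n)+
      then show "h (s(n := b)) = h s" "h (restrict s {0..<n}) = h s"
        by (auto simp: h_def indicator_def)
    qed
    have "emeasure ?P (A \<inter> {\<omega>. \<omega> j = a}) = (\<integral>\<^sup>+\<omega>. indicator (A \<inter> {\<omega>. \<omega> j = a}) \<omega> \<partial>?P)"
      using ev by simp
    also have "\<dots> = (\<integral>\<^sup>+s. indicator (A \<inter> {\<omega>. \<omega> j = a}) (glue s) \<partial>IT.PF.lim)"
      using ev by (intro nn_integral_distr[OF glue]) auto
    also have "\<dots> = (\<integral>\<^sup>+s. h s * indicator {s. s n = a} s \<partial>IT.PF.lim)"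
      by (intro nn_integral_cong) (auto simp: h_def indicator_def glue_def n)
    also have "\<dots> = (\<integral>\<^sup>+s. h s * ennreal (g a (past_at (int n) (glue s))) \<partial>IT.PF.lim)"
      using h by (rule nn_integral_lim_Suc)
    also have "\<dots> = (\<integral>\<^sup>+s. ennreal (indicator A (glue s) * g a (past_at j (glue s))) \<partial>IT.PF.lim)"
      by (intro nn_integral_cong) (auto simp: h_def n indicator_def)
    also have "\<dots> = (\<integral>\<^sup>+\<omega>. ennreal (indicator A \<omega> * g a (past_at j \<omega>)) \<partial>?P)"
      using m by (intro nn_integral_distr[OF glue, symmetric]) auto
    also have "\<dots> = ennreal (\<integral>\<omega>. indicator A \<omega> * g a (past_at j \<omega>) \<partial>?P)"
    proof (rule nn_integral_eq_integral)
      show "integrable ?P (\<lambda>\<omega>. indicator A \<omega> * g a (past_at j \<omega>))"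
        using m kernel_bounds
        by (intro P.integrable_const_bound[where B=1]) (auto simp: indicator_def)
    qed (auto simp: kernel_bounds indicator_def)
    finally show ?thesis
      by (simp add: measure_def kernel_bounds)
  qed
  have "AE \<omega> in ?P. real_cond_exp ?P (coord_algebra {..<j}) (indicator {\<omega>. \<omega> j = a}) \<omega> =
      g a (past_at j \<omega>)" if "0 \<le> j" for j a
    using path_law_iff_step[OF g P.prob_space_axioms, of j a] step[OF that] by simp
  then show "is_path_law g x ?P"
    using P.prob_space_axioms past by (simp add: is_path_law_def)
qed

end

theorem ex1_path_law:
  assumes "prob_kernel g"
  shows "\<exists>!P. is_path_law g x P"
  using path_law_exists[OF assms] path_law_unique[OF assms] by blast

end

theory Submission
  imports Defs
begin

text \<open>
  The Hellinger affinity of the laws of the first \<open>n\<close> symbols started from two pasts is a sum of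
  products of one-step affinities, and \<open>1 -\<close> a one-step affinity is comparable to the squared
  difference of the kernel at the two pasts, provided the kernel is bounded away from \<open>0\<close>.

  Under the \<open>\<ell>\<^sup>2\<close> criterion the affinity is therefore bounded below uniformly in \<open>n\<close> and in the
  pasts. If a tail event \<open>A\<close> had positive probability from \<open>x\<close> and its complement had positive
  probability from \<open>y\<close>, one could find finite continuations of \<open>x\<close> and \<open>y\<close>, of the same length,
  from which \<open>A\<close> is almost certain and almost impossible respectively, contradicting this bound.

  Conversely, start from the two constant pasts and append arbitrary words of a common length. Up to
  a square-summable error, the kernels then differ at step \<open>k\<close> by at least a multiple of the variation
  bound at (a multiple of) \<open>k\<close>, whatever symbols are produced in between. If the \<open>\<ell>\<^sup>2\<close> criterion
  fails, all these affinities tend to \<open>0\<close>, so the two laws are nearly singular on every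
  \<open>\<F>\<^bsub>[n,\<infinity>)\<^esub>\<close>, and Borel--Cantelli produces a tail event separating them.
\<close>

subsection \<open>Words and Hellinger affinities\<close>

definition words :: "nat \<Rightarrow> spin list set" where
  "words n = {u. length u = n}"

lemma finite_words [simp]: "finite (words n)"
  using finite_lists_length_eq[of "UNIV :: spin set" n] by (simp add: words_def)

lemma words_0: "words 0 = {[]}"
  by (auto simp: words_def)

lemma sum_words_Suc: "(\<Sum>u\<in>words (Suc n). f u) = (\<Sum>u\<in>words n. \<Sum>a\<in>UNIV. f (a # u))"
proof -
  have "words (Suc n) = (\<lambda>(u, a). a # u) ` (words n \<times> UNIV)"
    by (auto simp: words_def image_iff length_Suc_conv)
  moreover have "inj_on (\<lambda>(u, a). a # u) (words n \<times> (UNIV :: spin set))"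
    by (auto simp: inj_on_def)
  ultimately show ?thesis
    by (simp add: sum.reindex sum.cartesian_product case_prod_unfold)
qed

lemma concat_past_Nil [simp]: "concat_past [] x = x"
  by (simp add: concat_past_def)

lemma concat_past_append: "concat_past (u @ w) x = concat_past u (concat_past w x)"
  by (auto simp: concat_past_def fun_eq_iff nth_append)

text \<open>The head of a word is its latest symbol, so each step of the recursion splits off the
  last transition. This is the law of the first symbols produced from the past
  \<open>x\<close>.\<close>

primrec word_prob :: "(spin \<Rightarrow> past \<Rightarrow> real) \<Rightarrow> past \<Rightarrow> spin list \<Rightarrow> real" where
  "word_prob g x [] = 1"
| "word_prob g x (a # u) = g a (concat_past u x) * word_prob g x u"

text \<open>Chain rule: \<open>w\<close> is the older part of \<open>v @ w\<close>, so
  \<open>v\<close> is produced from the past already extended by \<open>w\<close>.\<close>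

lemma word_prob_append: "word_prob g x (v @ w) = word_prob g (concat_past w x) v * word_prob g x w"
  by (induction v) (auto simp: concat_past_append)

lemma word_prob_nonneg:
  assumes "prob_kernel g"
  shows "0 \<le> word_prob g x u"
  using assms by (induction u) (auto simp: prob_kernel_def)

lemma sum_word_prob:
  assumes "prob_kernel g"
  shows "(\<Sum>u\<in>words n. word_prob g x u) = 1"
proof (induction n)
  case (Suc n)
  then show ?case
    using assms by (simp add: sum_words_Suc sum_distrib_right[symmetric] prob_kernel_def)
qed (simp add: words_0)

lemma sum_word_prob_le_1:
  assumes "prob_kernel g" "U \<subseteq> words n"
  shows "(\<Sum>u\<in>U. word_prob g x u) \<le> 1"
  using sum_mono2[OF finite_words assms(2), of "word_prob g x"] sum_word_prob[OF assms(1), of x n]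
    word_prob_nonneg[OF assms(1)] by simp

lemma word_prob_le_1:
  assumes "prob_kernel g"
  shows "word_prob g x u \<le> 1"
  using sum_word_prob_le_1[OF assms, of "{u}" "length u"] by (simp add: words_def)

text \<open>The Bhattacharyya coefficient of two laws on \<open>words n\<close>: it is
  \<open>1\<close> for equal laws and \<open>0\<close> for mutually singular ones.\<close>

definition affinity :: "(spin \<Rightarrow> past \<Rightarrow> real) \<Rightarrow> nat \<Rightarrow> past \<Rightarrow> past \<Rightarrow> real" where
  "affinity g n x y = (\<Sum>u\<in>words n. sqrt (word_prob g x u * word_prob g y u))"

lemma affinity_nonneg:
  assumes "prob_kernel g"
  shows "0 \<le> affinity g n x y"
  unfolding affinity_def using word_prob_nonneg[OF assms] by (intro sum_nonneg) auto

text \<open>The affinity of two laws on \<open>spin\<close> that give \<open>Plus\<close> the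
  probabilities \<open>p\<close> and \<open>q\<close>.\<close>

definition step_affinity :: "real \<Rightarrow> real \<Rightarrow> real" where
  "step_affinity p q = sqrt (p * q) + sqrt ((1 - p) * (1 - q))"

lemma affinity_0 [simp]: "affinity g 0 x y = 1"
  by (simp add: affinity_def words_0)

lemma affinity_Suc:
  assumes "prob_kernel g"
  shows "affinity g (Suc n) x y = (\<Sum>u\<in>words n. sqrt (word_prob g x u * word_prob g y u) *
    step_affinity (g Plus (concat_past u x)) (g Plus (concat_past u y)))"
proof -
  have "g Minus z = 1 - g Plus z" for z
    using assms by (auto simp: prob_kernel_def UNIV_spin algebra_simps)
  then show ?thesis
    unfolding affinity_def sum_words_Suc step_affinity_def
    by (intro sum.cong refl) (simp add: UNIV_spin real_sqrt_mult distrib_left mult_ac)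
qed

text \<open>Bounds that depend only on the length of the appended word can be pulled out of the sum
  over words, one step at a time.\<close>

lemma affinity_le_prod:
  assumes g: "prob_kernel g"
    and c: "\<And>k u. u \<in> words k \<Longrightarrow> step_affinity (g Plus (concat_past u x)) (g Plus (concat_past u y)) \<le> c k"
    and c0: "\<And>k. 0 \<le> c k"
  shows "affinity g n x y \<le> (\<Prod>k<n. c k)"
proof (induction n)
  case (Suc n)
  have "affinity g (Suc n) x y \<le> (\<Sum>u\<in>words n. sqrt (word_prob g x u * word_prob g y u) * c n)"
    unfolding affinity_Suc[OF g] using c word_prob_nonneg[OF g] by (intro sum_mono mult_left_mono) auto
  also have "\<dots> = affinity g n x y * c n"
    by (simp add: affinity_def sum_distrib_right)
  also have "\<dots> \<le> (\<Prod>k<n. c k) * c n"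
    using Suc c0 by (intro mult_right_mono)
  finally show ?case by simp
qed simp

lemma affinity_ge_prod:
  assumes g: "prob_kernel g"
    and c: "\<And>k u. u \<in> words k \<Longrightarrow> c k \<le> step_affinity (g Plus (concat_past u x)) (g Plus (concat_past u y))"
    and c0: "\<And>k. 0 \<le> c k"
  shows "(\<Prod>k<n. c k) \<le> affinity g n x y"
proof (induction n)
  case (Suc n)
  have "(\<Prod>k<n. c k) * c n \<le> affinity g n x y * c n"
    using Suc c0 by (intro mult_right_mono)
  also have "\<dots> = (\<Sum>u\<in>words n. sqrt (word_prob g x u * word_prob g y u) * c n)"
    by (simp add: affinity_def sum_distrib_right)
  also have "\<dots> \<le> affinity g (Suc n) x y"
    unfolding affinity_Suc[OF g] using c word_prob_nonneg[OF g] by (intro sum_mono mult_left_mono) auto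
  finally show ?case by simp
qed simp

section \<open>Hellinger distance of two-point laws\<close>

lemma one_minus_step_affinity:
  assumes "0 \<le> p" "p \<le> 1" "0 \<le> q" "q \<le> 1"
  shows "1 - step_affinity p q = ((sqrt p - sqrt q)\<^sup>2 + (sqrt (1 - p) - sqrt (1 - q))\<^sup>2) / 2"
  using assms unfolding step_affinity_def power2_diff real_sqrt_mult by simp

lemma sqrt_diff_power2:
  assumes "0 \<le> p" "0 \<le> q"
  shows "(p - q)\<^sup>2 = (sqrt p - sqrt q)\<^sup>2 * (sqrt p + sqrt q)\<^sup>2"
proof -
  have "p - q = (sqrt p - sqrt q) * (sqrt p + sqrt q)"
    using assms by (simp add: algebra_simps)
  then show ?thesis
    by (metis power_mult_distrib)
qed

text \<open>Two square roots of probabilities sum to at most \<open>2\<close>, so each squared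
  difference of roots is at least \<open>(p - q)\<^sup>2 / 4\<close>; the Hellinger identity
  averages two such terms.\<close>

lemma step_affinity_le:
  assumes "0 \<le> p" "p \<le> 1" "0 \<le> q" "q \<le> 1"
  shows "step_affinity p q \<le> 1 - (p - q)\<^sup>2 / 4"
proof -
  have *: "(r - s)\<^sup>2 / 4 \<le> (sqrt r - sqrt s)\<^sup>2" if "0 \<le> r" "r \<le> 1" "0 \<le> s" "s \<le> 1" for r s :: real
  proof -
    have "sqrt r \<le> 1" "sqrt s \<le> 1" "0 \<le> sqrt r" "0 \<le> sqrt s"
      using that by auto
    then have "(sqrt r + sqrt s)\<^sup>2 \<le> 2\<^sup>2"
      by (intro power_mono) linarith+
    then have "(sqrt r - sqrt s)\<^sup>2 * (sqrt r + sqrt s)\<^sup>2 \<le> (sqrt r - sqrt s)\<^sup>2 * 2\<^sup>2"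
      by (intro mult_left_mono) auto
    then show ?thesis
      using sqrt_diff_power2[of r s] that by simp
  qed
  have "(1 - p - (1 - q))\<^sup>2 = (p - q)\<^sup>2"
    by (simp add: power2_commute)
  then show ?thesis
    using one_minus_step_affinity[OF assms] *[of p q] *[of "1 - p" "1 - q"] assms by simp
qed

text \<open>Here the roots sum to at least \<open>2 * sqrt e\<close>, which reverses the comparison.
  The second bound is cruder but stays positive even where the first is negative.\<close>

lemma step_affinity_ge:
  assumes "0 < e" "e \<le> p" "p \<le> 1 - e" "e \<le> q" "q \<le> 1 - e"
  shows "1 - (p - q)\<^sup>2 / (4 * e) \<le> step_affinity p q" "2 * e \<le> step_affinity p q"
proof -
  have *: "(sqrt r - sqrt s)\<^sup>2 \<le> (r - s)\<^sup>2 / (4 * e)" if "e \<le> r" "e \<le> s" for r s :: real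
  proof -
    have "2 * sqrt e \<le> sqrt r + sqrt s"
      using that by (smt (verit) real_sqrt_le_iff)
    then have "(2 * sqrt e)\<^sup>2 \<le> (sqrt r + sqrt s)\<^sup>2"
      using assms(1) by (intro power_mono) auto
    then have "4 * e \<le> (sqrt r + sqrt s)\<^sup>2"
      using assms(1) by (simp add: power_mult_distrib)
    then have "(sqrt r - sqrt s)\<^sup>2 * (4 * e) \<le> (sqrt r - sqrt s)\<^sup>2 * (sqrt r + sqrt s)\<^sup>2"
      by (intro mult_left_mono) auto
    then show ?thesis
      using sqrt_diff_power2[of r s] that assms(1) by (simp add: field_simps)
  qed
  have "(1 - p - (1 - q))\<^sup>2 = (p - q)\<^sup>2"
    by (simp add: power2_commute)
  then show "1 - (p - q)\<^sup>2 / (4 * e) \<le> step_affinity p q"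
    using one_minus_step_affinity[of p q] *[of p q] *[of "1 - p" "1 - q"] assms by simp
  have "e \<le> sqrt (r * s)" if "e \<le> r" "e \<le> s" for r s
    using mult_mono[OF that] assms(1) that by (intro real_le_rsqrt) (auto simp: power2_eq_square)
  from this[of p q] this[of "1 - p" "1 - q"] show "2 * e \<le> step_affinity p q"
    using assms by (simp add: step_affinity_def)
qed

text \<open>
  The constant makes both regimes work: for \<open>(p - q)\<^sup>2 \<le> 2 * e\<close> the quadratic lower bound is used,
  and for larger differences the trivial bound \<open>2 * e\<close>.
\<close>

lemma step_affinity_ge_exp:
  assumes e: "0 < e" "e \<le> p" "p \<le> 1 - e" "e \<le> q" "q \<le> 1 - e"
  shows "exp (- ((1 - ln (2 * e)) / (2 * e)) * (p - q)\<^sup>2) \<le> step_affinity p q"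
proof -
  define t where "t = (p - q)\<^sup>2 / (4 * e)"
  have t0: "0 \<le> t"
    using e by (simp add: t_def)
  have "2 * e \<le> 1"
    using e by linarith
  then have ln: "ln (2 * e) \<le> 0"
    using e by simp
  have E: "- ((1 - ln (2 * e)) / (2 * e)) * (p - q)\<^sup>2 = - (2 * t) + ln (2 * e) * (2 * t)"
    using e by (simp add: t_def field_simps)
  show ?thesis
  proof (cases "t \<le> 1 / 2")
    case True
    have "exp (- (2 * t) + ln (2 * e) * (2 * t)) \<le> exp (- (2 * t))"
      using ln t0 by (simp add: mult_nonpos_nonneg)
    also have "\<dots> \<le> 1 - t"
    proof -
      have "- t - 2 * t\<^sup>2 \<le> ln (1 - t)"
        using ln_one_minus_pos_lower_bound[of t] t0 True by simp
      moreover have "2 * t\<^sup>2 \<le> t"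
        using mult_right_mono[OF True t0] by (simp add: power2_eq_square)
      ultimately have "- (2 * t) \<le> ln (1 - t)"
        by linarith
      then show ?thesis
        using True by (simp add: ln_ge_iff)
    qed
    also have "\<dots> \<le> step_affinity p q"
      using step_affinity_ge(1)[OF e] by (simp add: t_def)
    finally show ?thesis
      unfolding E .
  next
    case False
    have "ln (2 * e) * (2 * t) \<le> ln (2 * e) * 1"
      using False ln by (intro mult_left_mono_neg) auto
    then have "exp (- (2 * t) + ln (2 * e) * (2 * t)) \<le> exp (ln (2 * e))"
      using t0 by simp
    also have "\<dots> = 2 * e"
      using e by simp
    also have "\<dots> \<le> step_affinity p q"
      by (rule step_affinity_ge(2)[OF e])
    finally show ?thesis
      unfolding E .
  qed
qed

section \<open>Variation rates and bounds on affinities\<close>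

lemma abs_diff_le_variation:
  assumes "prob_kernel g" "length w = k"
  shows "\<bar>g a (concat_past w x) - g a (concat_past w y)\<bar> \<le> variation k g"
  unfolding variation_def
proof (rule cSup_upper)
  \<comment> \<open>A supremum of reals is an upper bound only for a bounded set; this bound
    supplies that.\<close>
  have "\<bar>g a z - g a z'\<bar> \<le> 1" for a z z'
  proof -
    have "0 \<le> g a z" "g a z \<le> 1" "0 \<le> g a z'" "g a z' \<le> 1"
      using assms(1) by (auto simp: prob_kernel_def)
    then show ?thesis by linarith
  qed
  then show "bdd_above {\<bar>g a (concat_past w x) - g a (concat_past w y)\<bar> | a w x y. length w = k}"
    by (auto intro!: bdd_aboveI)
qed (use assms(2) in blast)

lemma variation_nonneg:
  assumes "prob_kernel g"
  shows "0 \<le> variation k g"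
  using abs_diff_le_variation[OF assms length_replicate, where a=Plus and x="\<lambda>_. Plus" and y="\<lambda>_. Plus"]
  by simp

lemma variation_le:
  assumes "\<And>a w x y. length w = k \<Longrightarrow> \<bar>g a (concat_past w x) - g a (concat_past w y)\<bar> \<le> c"
  shows "variation k g \<le> c"
  unfolding variation_def
proof (rule cSup_least)
  have "\<exists>w :: spin list. length w = k"
    by (rule exI[of _ "replicate k Plus"]) simp
  then show "{\<bar>g a (concat_past w x) - g a (concat_past w y)\<bar> | a w x y. length w = k} \<noteq> {}"
    by blast
qed (use assms in blast)

text \<open>Once the same \<open>k\<close> symbols are appended to two pasts, the kernels differ by
  at most \<open>variation k g\<close>. The product of the one-step affinities therefore stays above
  the exponential of a negative multiple of a convergent sum.\<close>

lemma affinity_bounded_below: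
  assumes g: "prob_kernel g" and e: "0 < e" "\<And>a x. e \<le> g a x" and l2: "l2_criterion g"
  shows "\<exists>c>0. \<forall>n x y. c \<le> affinity g n x y"
proof -
  define L where "L = (1 - ln (2 * e)) / (2 * e)"
  have eq: "g Minus z = 1 - g Plus z" for z
    using g by (auto simp: prob_kernel_def UNIV_spin algebra_simps)
  have b: "e \<le> g Plus z" "g Plus z \<le> 1 - e" for z
    using e(2)[of Plus z] e(2)[of Minus z] eq by auto
  have "2 * e \<le> 1"
    using b[of undefined] by linarith
  then have L: "0 \<le> L"
    using e ln_le_zero_iff[of "2 * e"] unfolding L_def by (intro divide_nonneg_nonneg) linarith+
  \<comment> \<open>The criterion starts at length \<open>1\<close>, the product at the empty word;
    the additional term does not affect convergence.\<close>
  have summ: "summable (\<lambda>k. (variation k g)\<^sup>2)"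
    using l2 summable_Suc_iff[of "\<lambda>k. (variation k g)\<^sup>2"] by (simp add: l2_criterion_def)
  show ?thesis
  proof (intro exI conjI allI)
    fix n x y
    have "exp (- L * (\<Sum>k. (variation k g)\<^sup>2)) \<le> exp (- L * (\<Sum>k<n. (variation k g)\<^sup>2))"
      using L sum_le_suminf[OF summ, of "{..<n}"] by (simp add: mult_left_mono)
    also have "\<dots> = (\<Prod>k<n. exp (- L * (variation k g)\<^sup>2))"
      by (simp add: exp_sum sum_distrib_left)
    also have "\<dots> \<le> affinity g n x y"
    proof (rule affinity_ge_prod[OF g])
      fix k u assume "u \<in> words k"
      then have "\<bar>g Plus (concat_past u x) - g Plus (concat_past u y)\<bar> \<le> variation k g"
        by (intro abs_diff_le_variation[OF g]) (simp add: words_def)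
      then have "(g Plus (concat_past u x) - g Plus (concat_past u y))\<^sup>2 \<le> (variation k g)\<^sup>2"
        using variation_nonneg[OF g, of k] by (simp add: abs_le_square_iff[symmetric])
      then have "exp (- L * (variation k g)\<^sup>2)
          \<le> exp (- L * (g Plus (concat_past u x) - g Plus (concat_past u y))\<^sup>2)"
        using L by (simp add: mult_left_mono)
      also have "\<dots> \<le> step_affinity (g Plus (concat_past u x)) (g Plus (concat_past u y))"
        unfolding L_def using e b by (intro step_affinity_ge_exp) auto
      finally show "exp (- L * (variation k g)\<^sup>2)
          \<le> step_affinity (g Plus (concat_past u x)) (g Plus (concat_past u y))" .
    qed simp
    finally show "exp (- L * (\<Sum>k. (variation k g)\<^sup>2)) \<le> affinity g n x y" .
  qed simp
qed

text \<open>Cauchy-Schwarz on \<open>U\<close> and on its complement, with one of the two factors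
  bounded by \<open>1\<close>. A test \<open>U\<close> that separates the laws well thus forces a
  small affinity.\<close>

lemma affinity_le_tests:
  assumes g: "prob_kernel g" and U: "U \<subseteq> words n"
  shows "affinity g n x y \<le> sqrt (\<Sum>u\<in>words n - U. word_prob g x u) + sqrt (\<Sum>u\<in>U. word_prob g y u)"
proof -
  have CS: "(\<Sum>u\<in>V. sqrt (word_prob g x u * word_prob g y u)) \<le>
      sqrt (\<Sum>u\<in>V. word_prob g x u) * sqrt (\<Sum>u\<in>V. word_prob g y u)" for V
    using L2_set_mult_ineq[of "\<lambda>u. sqrt (word_prob g x u)" "\<lambda>u. sqrt (word_prob g y u)" V]
      word_prob_nonneg[OF g]
    by (simp add: L2_set_def real_sqrt_mult)
  have le1: "sqrt (\<Sum>u\<in>V. word_prob g z u) \<le> 1" "0 \<le> sqrt (\<Sum>u\<in>V. word_prob g z u)"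
    if "V \<subseteq> words n" for V z
    using sum_word_prob_le_1[OF g that] word_prob_nonneg[OF g] by (auto simp: sum_nonneg)
  have "affinity g n x y = (\<Sum>u\<in>words n - U. sqrt (word_prob g x u * word_prob g y u)) +
      (\<Sum>u\<in>U. sqrt (word_prob g x u * word_prob g y u))"
    unfolding affinity_def by (rule sum.subset_diff[OF U finite_words])
  also have "\<dots> \<le> sqrt (\<Sum>u\<in>words n - U. word_prob g x u) * 1 + 1 * sqrt (\<Sum>u\<in>U. word_prob g y u)"
    using U by (intro add_mono order_trans[OF CS] mult_left_mono mult_right_mono le1) auto
  finally show ?thesis by simp
qed

lemma sum_squares_filterlim_at_top:
  fixes d :: "nat \<Rightarrow> real"
  assumes "\<not> summable (\<lambda>k. (d k)\<^sup>2)"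
  shows "filterlim (\<lambda>n. \<Sum>k<n. (d k)\<^sup>2) at_top sequentially"
proof -
  have "\<exists>N. \<forall>n\<ge>N. B \<le> (\<Sum>k<n. (d k)\<^sup>2)" for B
  proof -
    have "\<exists>N. \<not> (\<Sum>k<N. (d k)\<^sup>2) \<le> B"
    proof (rule ccontr)
      assume "\<nexists>N. \<not> (\<Sum>k<N. (d k)\<^sup>2) \<le> B"
      then have "(\<Sum>k\<le>n. (d k)\<^sup>2) \<le> B" for n
        unfolding lessThan_Suc_atMost[symmetric] by blast
      then have "summable (\<lambda>k. (d k)\<^sup>2)"
        by (intro bounded_imp_summable[where B=B]) auto
      with assms show False ..
    qed
    then obtain N where N: "B \<le> (\<Sum>k<N. (d k)\<^sup>2)"
      using linear by blast
    have "B \<le> (\<Sum>k<n. (d k)\<^sup>2)" if "N \<le> n" for n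
      using that by (intro order_trans[OF N sum_mono2]) auto
    then show ?thesis
      by blast
  qed
  then show ?thesis
    by (simp add: filterlim_at_top eventually_sequentially)
qed

text \<open>\<open>a\<close> is the main term and \<open>e\<close> a square-summable error. Since
  \<open>a\<close> exceeds the positive part of \<open>a - e\<close> by at most the modulus of
  \<open>e\<close>, the squares of that positive part diverge as well, and they drive the product of
  one-step affinities to \<open>0\<close>.\<close>

lemma affinity_tendsto_0:
  assumes g: "prob_kernel g"
    and d: "\<And>k u. u \<in> words k \<Longrightarrow>
      a k - e k \<le> g Plus (concat_past u x) - g Plus (concat_past u y)"
    and a: "\<And>k. 0 \<le> a k" "\<not> summable (\<lambda>k. (a k)\<^sup>2)" and e: "summable (\<lambda>k. (e k)\<^sup>2)"
  shows "(\<lambda>n. affinity g n x y) \<longlonglongrightarrow> 0"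
proof -
  \<comment> \<open>A negative lower bound on a difference says nothing about its square, so only
    the positive part is kept.\<close>
  define b where "b k = max 0 (a k - e k)" for k
  have bnd: "0 \<le> g Plus z" "g Plus z \<le> 1" for z
    using g by (auto simp: prob_kernel_def)
  have nb: "\<not> summable (\<lambda>k. (b k)\<^sup>2)"
  proof
    assume "summable (\<lambda>k. (b k)\<^sup>2)"
    then have "summable (\<lambda>k. 2 * (b k)\<^sup>2 + 2 * (e k)\<^sup>2)"
      using e by (intro summable_add summable_mult)
    moreover have "norm ((a k)\<^sup>2) \<le> 2 * (b k)\<^sup>2 + 2 * (e k)\<^sup>2" for k
    proof -
      have "\<bar>a k\<bar> \<le> \<bar>b k + \<bar>e k\<bar>\<bar>"
        using a(1)[of k] by (auto simp: b_def)
      then have "(a k)\<^sup>2 \<le> (b k + \<bar>e k\<bar>)\<^sup>2"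
        by (simp add: abs_le_square_iff)
      also have "\<dots> \<le> 2 * (b k)\<^sup>2 + 2 * (e k)\<^sup>2"
        using sum_squares_bound[of "b k" "\<bar>e k\<bar>"] by (simp add: power2_sum)
      finally show ?thesis by simp
    qed
    ultimately have "summable (\<lambda>k. (a k)\<^sup>2)"
      by (rule summable_comparison_test'[where N=0])
    with a(2) show False by simp
  qed
  have le: "affinity g n x y \<le> exp (- (\<Sum>k<n. (b k)\<^sup>2) / 4)" for n
  proof -
    have "affinity g n x y \<le> (\<Prod>k<n. exp (- (b k)\<^sup>2 / 4))"
    proof (rule affinity_le_prod[OF g])
      fix k u assume u: "u \<in> words k"
      let ?d = "g Plus (concat_past u x) - g Plus (concat_past u y)"
      have "\<bar>b k\<bar> \<le> \<bar>?d\<bar>"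
        using d[OF u] by (auto simp: b_def)
      then have "(b k)\<^sup>2 \<le> ?d\<^sup>2"
        by (simp add: abs_le_square_iff)
      have "step_affinity (g Plus (concat_past u x)) (g Plus (concat_past u y)) \<le> 1 - ?d\<^sup>2 / 4"
        using bnd by (intro step_affinity_le)
      also have "\<dots> \<le> 1 + (- (b k)\<^sup>2 / 4)"
        using \<open>(b k)\<^sup>2 \<le> ?d\<^sup>2\<close> by simp
      also have "\<dots> \<le> exp (- (b k)\<^sup>2 / 4)"
        by (rule exp_ge_add_one_self)
      finally show "step_affinity (g Plus (concat_past u x)) (g Plus (concat_past u y)) \<le> exp (- (b k)\<^sup>2 / 4)" .
    qed simp
    also have "\<dots> = exp (\<Sum>k<n. - (b k)\<^sup>2 / 4)"
      by (simp add: exp_sum)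
    also have "(\<Sum>k<n. - (b k)\<^sup>2 / 4) = - (\<Sum>k<n. (b k)\<^sup>2) / 4"
      by (simp add: sum_negf sum_divide_distrib)
    finally show ?thesis .
  qed
  have "filterlim (\<lambda>n. (1 / 4) * (\<Sum>k<n. (b k)\<^sup>2)) at_top sequentially"
    by (rule filterlim_tendsto_pos_mult_at_top[OF tendsto_const _ sum_squares_filterlim_at_top[OF nb]]) simp
  then have "filterlim (\<lambda>n. - ((1 / 4) * (\<Sum>k<n. (b k)\<^sup>2))) at_bot sequentially"
    by (simp add: filterlim_uminus_at_bot)
  then have "(\<lambda>n. exp (- ((1 / 4) * (\<Sum>k<n. (b k)\<^sup>2)))) \<longlonglongrightarrow> 0"
    by (rule filterlim_compose[OF exp_at_bot])
  then have "(\<lambda>n. exp (- (\<Sum>k<n. (b k)\<^sup>2) / 4)) \<longlonglongrightarrow> 0"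
    by simp
  then show ?thesis
    by (rule Lim_null_comparison[rotated]) (use le affinity_nonneg[OF g] in auto)
qed

subsection \<open>Blocks under the path law\<close>

text \<open>The \<open>n\<close> symbols before time \<open>j\<close>, most recent first.\<close>

primrec block :: "int \<Rightarrow> nat \<Rightarrow> path \<Rightarrow> spin list" where
  "block j 0 \<omega> = []"
| "block j (Suc n) \<omega> = \<omega> (j - 1) # block (j - 1) n \<omega>"

lemma length_block [simp]: "length (block j n \<omega>) = n"
  by (induction n arbitrary: j) auto

lemma block_in_words [simp]: "block j n \<omega> \<in> words n"
  by (simp add: words_def)

lemma block_append: "block j (m + n) \<omega> = block j m \<omega> @ block (j - int m) n \<omega>"
  by (induction m arbitrary: j) (auto simp: algebra_simps)

lemma past_at_block: "past_at j \<omega> = concat_past (block j n \<omega>) (past_at (j - int n) \<omega>)"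
proof (induction n arbitrary: j)
  case (Suc n)
  have "past_at j \<omega> = concat_past [\<omega> (j - 1)] (past_at (j - 1) \<omega>)"
    by (auto simp: past_at_def concat_past_def fun_eq_iff algebra_simps of_nat_diff)
  also have "past_at (j - 1) \<omega> = concat_past (block (j - 1) n \<omega>) (past_at (j - 1 - int n) \<omega>)"
    by (rule Suc)
  finally show ?case
    by (simp add: concat_past_append[symmetric] algebra_simps)
qed simp

lemma block_event_eq:
  assumes "{j - int n..<j} \<subseteq> I"
  shows "{\<omega>. block j n \<omega> = u} \<in> sets (coord_algebra I)"
  using assms
proof (induction n arbitrary: j u)
  case 0
  then show ?case
    using sets.top[of "coord_algebra I"] sets.empty_sets[of "coord_algebra I"] by (cases u) auto
next
  case (Suc n)
  show ?case
  proof (cases u)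
    case (Cons a v)
    have "{j - 1 - int n..<j - 1} \<subseteq> I" "j - 1 \<in> I"
      using Suc.prems by (auto simp: subset_iff)
    then have "{\<omega>. \<omega> (j - 1) = a} \<inter> {\<omega>. block (j - 1) n \<omega> = v} \<in> sets (coord_algebra I)"
      by (intro sets.Int coord_event Suc.IH)
    moreover have "{\<omega>. block j (Suc n) \<omega> = u} = {\<omega>. \<omega> (j - 1) = a} \<inter> {\<omega>. block (j - 1) n \<omega> = v}"
      by (auto simp: Cons)
    ultimately show ?thesis by simp
  qed simp
qed

lemma block_event:
  assumes "{j - int n..<j} \<subseteq> I"
  shows "{\<omega>. block j n \<omega> \<in> U} \<in> sets (coord_algebra I)"
proof -
  have "{\<omega>. block j n \<omega> \<in> U} = (\<Union>u\<in>U \<inter> words n. {\<omega>. block j n \<omega> = u})"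
    by auto
  also have "\<dots> \<in> sets (coord_algebra I)"
    using block_event_eq[OF assms] by (intro sets.finite_UN) auto
  finally show ?thesis .
qed

text \<open>On the event that the first symbols spell \<open>v\<close>, the past seen at time
  \<open>n\<close> is almost surely \<open>concat_past v x\<close>, so the conditional probability
  is constant there and factors out.\<close>

lemma measure_block_eq:
  assumes g: "prob_kernel g" and P: "is_path_law g x P" and u: "u \<in> words n"
  shows "measure P {\<omega>. block (int n) n \<omega> = u} = word_prob g x u"
  using u
proof (induction n arbitrary: u)
  case 0
  interpret prob_space P
    using P by (simp add: is_path_law_def)
  have "space P = UNIV"
    using P sets_eq_imp_space_eq[of P "coord_algebra UNIV"] by (simp add: is_path_law_def)
  then show ?case
    using 0 prob_space by (simp add: words_0)
next
  case (Suc n)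
  interpret prob_space P
    using P by (simp add: is_path_law_def)
  have sets: "sets P = sets (coord_algebra UNIV)"
    using P by (simp add: is_path_law_def)
  then have space: "space P = UNIV"
    using sets_eq_imp_space_eq[of P "coord_algebra UNIV"] by simp
  obtain a v where u: "u = a # v" and v: "v \<in> words n"
    using Suc.prems by (auto simp: words_def length_Suc_conv)
  let ?A = "{\<omega>. block (int n) n \<omega> = v}"
  have A: "?A \<in> sets (coord_algebra {..<int n})"
    by (rule block_event_eq) auto
  have AP: "?A \<in> sets P"
    unfolding sets by (rule block_event_eq) auto
  have past: "AE \<omega> in P. past_at 0 \<omega> = x"
    using P by (simp add: is_path_law_def)
  have "measure P {\<omega>. block (int (Suc n)) (Suc n) \<omega> = u} = measure P (?A \<inter> {\<omega>. \<omega> (int n) = a})"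
    by (rule arg_cong[where f="measure P"]) (auto simp: u)
  also have "\<dots> = (\<integral>\<omega>. indicator ?A \<omega> * g a (past_at (int n) \<omega>) \<partial>P)"
  proof -
    have "AE \<omega> in P. real_cond_exp P (coord_algebra {..<int n}) (indicator {\<omega>. \<omega> (int n) = a}) \<omega> =
        g a (past_at (int n) \<omega>)"
      using P by (simp add: is_path_law_def)
    then show ?thesis
      using path_law_iff_step[OF g prob_space_axioms sets, of "int n" a] A by blast
  qed
  also have "\<dots> = (\<integral>\<omega>. indicator ?A \<omega> * g a (concat_past v x) \<partial>P)"
  proof (rule integral_cong_AE)
    have "(\<lambda>\<omega>. g a (past_at (int n) \<omega>)) \<in> borel_measurable P"
      by (rule measurable_from_subalg[OF subalgebra_coord_algebra[OF sets] measurable_kernel_past_at[OF g]])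
    then show "(\<lambda>\<omega>. indicator ?A \<omega> * g a (past_at (int n) \<omega>)) \<in> borel_measurable P"
      using AP by (intro borel_measurable_times) auto
    show "(\<lambda>\<omega>. indicator ?A \<omega> * g a (concat_past v x)) \<in> borel_measurable P"
      using AP by (intro borel_measurable_times) auto
    show "AE \<omega> in P. indicator ?A \<omega> * g a (past_at (int n) \<omega>) = indicator ?A \<omega> * g a (concat_past v x)"
      using past
    proof eventually_elim
      case (elim \<omega>)
      then show ?case
        using past_at_block[of "int n" \<omega> n] by (auto simp: indicator_def)
    qed
  qed
  also have "\<dots> = measure P ?A * g a (concat_past v x)"
    using AP space by simp
  finally show ?case
    using Suc.IH[OF v] by (simp add: u)
qed

lemma measure_block:
  assumes g: "prob_kernel g" and P: "is_path_law g x P" and U: "U \<subseteq> words n"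
  shows "measure P {\<omega>. block (int n) n \<omega> \<in> U} = (\<Sum>u\<in>U. word_prob g x u)"
proof -
  interpret prob_space P
    using P by (simp add: is_path_law_def)
  have sets: "sets P = sets (coord_algebra UNIV)"
    using P by (simp add: is_path_law_def)
  have "finite U"
    using finite_subset[OF U finite_words] .
  have "{\<omega>. block (int n) n \<omega> \<in> U} = (\<Union>u\<in>U. {\<omega>. block (int n) n \<omega> = u})"
    by auto
  also have "measure P \<dots> = (\<Sum>u\<in>U. measure P {\<omega>. block (int n) n \<omega> = u})"
    using block_event_eq[of "int n" n UNIV] sets \<open>finite U\<close>
    by (intro finite_measure_finite_Union) (auto simp: disjoint_family_on_def)
  also have "\<dots> = (\<Sum>u\<in>U. word_prob g x u)"
    using U measure_block_eq[OF g P] by (intro sum.cong) auto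
  finally show ?thesis .
qed

lemma measure_two_blocks:
  assumes g: "prob_kernel g" and P: "is_path_law g x P" and V: "V \<subseteq> words n" and U: "U \<subseteq> words m"
  shows "measure P {\<omega>. block (int n) n \<omega> \<in> V \<and> block (int (n + m)) m \<omega> \<in> U} =
    (\<Sum>w\<in>V. word_prob g x w * (\<Sum>v\<in>U. word_prob g (concat_past w x) v))"
proof -
  \<comment> \<open>The later block stands in front of the earlier one; its fixed length
    \<open>m\<close> makes the splitting unique.\<close>
  let ?W = "(\<lambda>(w, v). v @ w) ` (V \<times> U)"
  have W: "?W \<subseteq> words (n + m)"
    using U V by (fastforce simp: words_def)
  have "length v = m" if "v \<in> U" for v
    using U that by (auto simp: words_def)
  then have inj: "inj_on (\<lambda>(w, v). v @ w) (V \<times> U)"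
    by (auto simp: inj_on_def)
  have "{\<omega>. block (int n) n \<omega> \<in> V \<and> block (int (n + m)) m \<omega> \<in> U} =
      {\<omega>. block (int (n + m)) (n + m) \<omega> \<in> ?W}"
  proof (intro Collect_cong)
    fix \<omega>
    have eq: "block (int (n + m)) (n + m) \<omega> = block (int (n + m)) m \<omega> @ block (int n) n \<omega>"
      using block_append[of "int (n + m)" m n \<omega>] by (simp add: add.commute)
    show "block (int n) n \<omega> \<in> V \<and> block (int (n + m)) m \<omega> \<in> U \<longleftrightarrow> block (int (n + m)) (n + m) \<omega> \<in> ?W"
    proof
      assume "block (int (n + m)) (n + m) \<omega> \<in> ?W"
      then obtain w v where wv: "w \<in> V" "v \<in> U" "block (int (n + m)) m \<omega> @ block (int n) n \<omega> = v @ w"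
        unfolding eq by auto
      moreover have "length v = m"
        using wv U by (auto simp: words_def)
      ultimately show "block (int n) n \<omega> \<in> V \<and> block (int (n + m)) m \<omega> \<in> U"
        by (simp add: append_eq_append_conv)
    next
      assume "block (int n) n \<omega> \<in> V \<and> block (int (n + m)) m \<omega> \<in> U"
      then show "block (int (n + m)) (n + m) \<omega> \<in> ?W"
        unfolding eq by (auto simp: image_iff)
    qed
  qed
  then have "measure P {\<omega>. block (int n) n \<omega> \<in> V \<and> block (int (n + m)) m \<omega> \<in> U} =
      (\<Sum>u\<in>?W. word_prob g x u)"
    using measure_block[OF g P W] by simp
  also have "\<dots> = (\<Sum>(w, v)\<in>V \<times> U. word_prob g x (v @ w))"
    by (subst sum.reindex[OF inj]) (simp add: case_prod_unfold)
  also have "\<dots> = (\<Sum>w\<in>V. word_prob g x w * (\<Sum>v\<in>U. word_prob g (concat_past w x) v))"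
    by (simp add: sum.cartesian_product[symmetric] word_prob_append sum_distrib_left mult.commute)
  finally show ?thesis .
qed

lemma path_law_is_path_law:
  assumes "prob_kernel g"
  shows "is_path_law g x (path_law g x)"
  unfolding path_law_def using ex1_path_law[OF assms] by (rule theI')

text \<open>Asking for all large \<open>m\<close> allows several approximations to be made with blocks of the same length.\<close>

definition block_approximable :: "path measure \<Rightarrow> path measure \<Rightarrow> nat \<Rightarrow> path set \<Rightarrow> bool" where
  "block_approximable P Q n A \<longleftrightarrow> (\<forall>\<eta>>0. \<exists>m0. \<forall>m\<ge>m0. \<exists>U\<subseteq>words m.
     measure P (sym_diff A {\<omega>. block (int (n + m)) m \<omega> \<in> U}) < \<eta> \<and>
     measure Q (sym_diff A {\<omega>. block (int (n + m)) m \<omega> \<in> U}) < \<eta>)"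

text \<open>Both blocks start at time \<open>n\<close>, so the longer one has its additional, later
  symbols in front; dropping them recovers the shorter block.\<close>

lemma block_event_extend:
  assumes "m0 \<le> m"
  shows "\<exists>U'\<subseteq>words m. {\<omega>. block (int (n + m0)) m0 \<omega> \<in> U} = {\<omega>. block (int (n + m)) m \<omega> \<in> U'}"
proof (intro exI conjI)
  let ?U' = "{v \<in> words m. drop (m - m0) v \<in> U}"
  have "block (int (n + m)) m \<omega> = block (int (n + m)) (m - m0) \<omega> @ block (int (n + m0)) m0 \<omega>" for \<omega>
    using block_append[of "int (n + m)" "m - m0" m0 \<omega>] assms by (simp add: of_nat_diff algebra_simps)
  then show "{\<omega>. block (int (n + m0)) m0 \<omega> \<in> U} = {\<omega>. block (int (n + m)) m \<omega> \<in> ?U'}"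
    using assms by (auto simp: words_def)
qed auto

context
  fixes P Q :: "path measure" and n :: nat
  assumes P: "prob_space P" "sets P = sets (coord_algebra UNIV)"
    and Q: "prob_space Q" "sets Q = sets (coord_algebra UNIV)"
begin

text \<open>One block length per accuracy is enough, since every longer block from time
  \<open>n\<close> determines the same event.\<close>

lemma block_approximableI:
  assumes "\<And>\<eta>. 0 < \<eta> \<Longrightarrow> \<exists>m U.
     measure P (sym_diff A {\<omega>. block (int (n + m)) m \<omega> \<in> U}) < \<eta> \<and>
     measure Q (sym_diff A {\<omega>. block (int (n + m)) m \<omega> \<in> U}) < \<eta>"
  shows "block_approximable P Q n A"
  unfolding block_approximable_def
proof (intro allI impI)
  fix \<eta> :: real assume "0 < \<eta>"
  then obtain m0 U where U: "measure P (sym_diff A {\<omega>. block (int (n + m0)) m0 \<omega> \<in> U}) < \<eta>"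
     "measure Q (sym_diff A {\<omega>. block (int (n + m0)) m0 \<omega> \<in> U}) < \<eta>"
    using assms by blast
  show "\<exists>m0. \<forall>m\<ge>m0. \<exists>U\<subseteq>words m.
     measure P (sym_diff A {\<omega>. block (int (n + m)) m \<omega> \<in> U}) < \<eta> \<and>
     measure Q (sym_diff A {\<omega>. block (int (n + m)) m \<omega> \<in> U}) < \<eta>"
  proof (intro exI[of _ m0] allI impI)
    fix m assume "m0 \<le> m"
    from block_event_extend[OF this, of n U] U
    show "\<exists>U\<subseteq>words m. measure P (sym_diff A {\<omega>. block (int (n + m)) m \<omega> \<in> U}) < \<eta> \<and>
     measure Q (sym_diff A {\<omega>. block (int (n + m)) m \<omega> \<in> U}) < \<eta>"
      by metis
  qed
qed

lemma block_approximable_coord: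
  assumes "int n \<le> i"
  shows "block_approximable P Q n {\<omega>. \<omega> i = a}"
proof (rule block_approximableI)
  fix \<eta> :: real assume "0 < \<eta>"
  \<comment> \<open>With this length the block covers the times from \<open>n\<close> to
    \<open>i\<close>, so \<open>\<omega> i\<close> is its head.\<close>
  let ?m = "nat (i + 1 - int n)"
  have "block (int (n + ?m)) ?m \<omega> = \<omega> i # block i (nat (i - int n)) \<omega>" for \<omega>
  proof -
    have "?m = Suc (nat (i - int n))" "int (n + ?m) = i + 1"
      using assms by auto
    then show ?thesis by simp
  qed
  then have "{\<omega>. \<omega> i = a} = {\<omega>. block (int (n + ?m)) ?m \<omega> \<in> {u. hd u = a}}"
    by simp
  then have "sym_diff {\<omega>. \<omega> i = a} {\<omega>. block (int (n + ?m)) ?m \<omega> \<in> {u. hd u = a}} = {}"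
    by blast
  then show "\<exists>m U. measure P (sym_diff {\<omega>. \<omega> i = a} {\<omega>. block (int (n + m)) m \<omega> \<in> U}) < \<eta> \<and>
     measure Q (sym_diff {\<omega>. \<omega> i = a} {\<omega>. block (int (n + m)) m \<omega> \<in> U}) < \<eta>"
    using \<open>0 < \<eta>\<close> by (metis measure_empty)
qed

lemma block_approximable_Compl:
  assumes "block_approximable P Q n A"
  shows "block_approximable P Q n (- A)"
proof (rule block_approximableI)
  fix \<eta> :: real assume "0 < \<eta>"
  then obtain m U where U: "measure P (sym_diff A {\<omega>. block (int (n + m)) m \<omega> \<in> U}) < \<eta>"
     "measure Q (sym_diff A {\<omega>. block (int (n + m)) m \<omega> \<in> U}) < \<eta>"
    using assms unfolding block_approximable_def by blast
  have "sym_diff (- A) {\<omega>. block (int (n + m)) m \<omega> \<in> - U} = sym_diff A {\<omega>. block (int (n + m)) m \<omega> \<in> U}"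
    by auto
  then show "\<exists>m U. measure P (sym_diff (- A) {\<omega>. block (int (n + m)) m \<omega> \<in> U}) < \<eta> \<and>
     measure Q (sym_diff (- A) {\<omega>. block (int (n + m)) m \<omega> \<in> U}) < \<eta>"
    using U by metis
qed

lemma measure_sym_diff_le:
  assumes R: "prob_space R" "sets R = sets (coord_algebra UNIV)"
    and "A \<in> sets R" "B \<in> sets R" "C \<in> sets R"
  shows "measure R (sym_diff A C) \<le> measure R (sym_diff A B) + measure R (sym_diff B C)"
proof -
  interpret prob_space R by fact
  have "measure R (sym_diff A C) \<le> measure R (sym_diff A B \<union> sym_diff B C)"
    using assms by (intro finite_measure_mono) auto
  also have "\<dots> \<le> measure R (sym_diff A B) + measure R (sym_diff B C)"
    using assms by (intro measure_Un_le) auto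
  finally show ?thesis .
qed

lemma block_approximable_empty: "block_approximable P Q n {}"
proof (rule block_approximableI)
  fix \<eta> :: real assume "0 < \<eta>"
  then have "measure R (sym_diff {} {\<omega>. block (int (n + 0)) 0 \<omega> \<in> {}}) < \<eta>" for R
    by simp
  then show "\<exists>m U. measure P (sym_diff {} {\<omega>. block (int (n + m)) m \<omega> \<in> U}) < \<eta> \<and>
     measure Q (sym_diff {} {\<omega>. block (int (n + m)) m \<omega> \<in> U}) < \<eta>"
    by blast
qed

lemma block_approximable_UN_le:
  fixes A :: "nat \<Rightarrow> path set"
  assumes A: "\<And>i. block_approximable P Q n (A i)" "\<And>i. A i \<in> sets (coord_algebra UNIV)"
  shows "block_approximable P Q n (\<Union>i<k. A i)"
proof (induction k)
  case 0
  show ?case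
    using block_approximable_empty by simp
next
  case (Suc k)
  let ?C = "\<lambda>m U. {\<omega>. block (int (n + m)) m \<omega> \<in> U}"
  have C: "?C m U \<in> sets (coord_algebra UNIV)" for m U
    by (rule block_event) simp
  show ?case
  proof (rule block_approximableI)
    fix \<eta> :: real assume \<eta>: "0 < \<eta>"
    obtain m1 where m1: "\<forall>m\<ge>m1. \<exists>U\<subseteq>words m. measure P (sym_diff (\<Union>i<k. A i) (?C m U)) < \<eta> / 2 \<and>
        measure Q (sym_diff (\<Union>i<k. A i) (?C m U)) < \<eta> / 2"
      using Suc \<eta> unfolding block_approximable_def by (meson half_gt_zero)
    obtain m2 where m2: "\<forall>m\<ge>m2. \<exists>U\<subseteq>words m. measure P (sym_diff (A k) (?C m U)) < \<eta> / 2 \<and>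
        measure Q (sym_diff (A k) (?C m U)) < \<eta> / 2"
      using A(1)[of k] \<eta> unfolding block_approximable_def by (meson half_gt_zero)
    \<comment> \<open>Each approximation is available for all large lengths, hence both for a common
      one.\<close>
    define m where "m = max m1 m2"
    obtain U1 where U1: "measure P (sym_diff (\<Union>i<k. A i) (?C m U1)) < \<eta> / 2"
        "measure Q (sym_diff (\<Union>i<k. A i) (?C m U1)) < \<eta> / 2"
      using m1[rule_format, of m] by (auto simp: m_def)
    obtain U2 where U2: "measure P (sym_diff (A k) (?C m U2)) < \<eta> / 2"
        "measure Q (sym_diff (A k) (?C m U2)) < \<eta> / 2"
      using m2[rule_format, of m] by (auto simp: m_def)
    have "measure R (sym_diff (\<Union>i<Suc k. A i) (?C m (U1 \<union> U2))) \<le>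
        measure R (sym_diff (\<Union>i<k. A i) (?C m U1)) + measure R (sym_diff (A k) (?C m U2))"
      if R: "prob_space R" "sets R = sets (coord_algebra UNIV)" for R
    proof -
      interpret prob_space R by fact
      have s: "(\<Union>i<k. A i) \<in> sets R" "A k \<in> sets R" "?C m U1 \<in> sets R" "?C m U2 \<in> sets R"
        "?C m (U1 \<union> U2) \<in> sets R" "(\<Union>i<Suc k. A i) \<in> sets R"
        using A(2) C[of m U1] C[of m U2] C[of m "U1 \<union> U2"] R(2) by auto
      have "measure R (sym_diff (\<Union>i<Suc k. A i) (?C m (U1 \<union> U2))) \<le>
          measure R (sym_diff (\<Union>i<k. A i) (?C m U1) \<union> sym_diff (A k) (?C m U2))"
        using s by (intro finite_measure_mono) (auto simp: lessThan_Suc)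
      also have "\<dots> \<le> measure R (sym_diff (\<Union>i<k. A i) (?C m U1)) + measure R (sym_diff (A k) (?C m U2))"
        using s by (intro measure_Un_le) auto
      finally show ?thesis .
    qed
    from this[OF P] this[OF Q] U1 U2
    have "measure P (sym_diff (\<Union>i<Suc k. A i) (?C m (U1 \<union> U2))) < \<eta>"
      "measure Q (sym_diff (\<Union>i<Suc k. A i) (?C m (U1 \<union> U2))) < \<eta>"
      by linarith+
    then show "\<exists>m U. measure P (sym_diff (\<Union>i<Suc k. A i) (?C m U)) < \<eta> \<and>
        measure Q (sym_diff (\<Union>i<Suc k. A i) (?C m U)) < \<eta>"
      by blast
  qed
qed

lemma block_approximable_UN:
  fixes A :: "nat \<Rightarrow> path set"
  assumes A: "\<And>i. block_approximable P Q n (A i)" "\<And>i. A i \<in> sets (coord_algebra UNIV)"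
  shows "block_approximable P Q n (\<Union>i. A i)"
proof (rule block_approximableI)
  fix \<eta> :: real assume \<eta>: "0 < \<eta>"
  let ?C = "\<lambda>m U. {\<omega>. block (int (n + m)) m \<omega> \<in> U}"
  let ?B = "\<lambda>k. \<Union>i<k. A i"
  have C: "?C m U \<in> sets (coord_algebra UNIV)" for m U
    by (rule block_event) simp
  \<comment> \<open>Continuity from above: what the finite unions miss decreases to the empty set.
    Stating this eventually lets one \<open>k\<close> serve both measures.\<close>
  have ev: "\<forall>\<^sub>F k in sequentially. measure R (sym_diff (\<Union>i. A i) (?B k)) < \<eta> / 2"
    if R: "prob_space R" "sets R = sets (coord_algebra UNIV)" for R
  proof -
    interpret prob_space R by fact
    have "(\<lambda>k. measure R ((\<Union>i. A i) - ?B k)) \<longlonglongrightarrow> measure R (\<Inter>k. (\<Union>i. A i) - ?B k)"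
      using A(2) R(2) by (intro finite_Lim_measure_decseq) (auto simp: decseq_def)
    moreover have "(\<Inter>k. (\<Union>i. A i) - ?B k) = {}"
      by (auto simp del: INT_simps UN_simps)
    ultimately have "(\<lambda>k. measure R ((\<Union>i. A i) - ?B k)) \<longlonglongrightarrow> 0"
      by (metis measure_empty)
    moreover have "sym_diff (\<Union>i. A i) (?B k) = (\<Union>i. A i) - ?B k" for k
      by auto
    ultimately show ?thesis
      using order_tendstoD(2)[of "\<lambda>k. measure R (sym_diff (\<Union>i. A i) (?B k))" 0 sequentially "\<eta> / 2"] \<eta>
      by simp
  qed
  from eventually_conj[OF ev[OF P] ev[OF Q]]
  obtain k where k: "measure P (sym_diff (\<Union>i. A i) (?B k)) < \<eta> / 2"
    "measure Q (sym_diff (\<Union>i. A i) (?B k)) < \<eta> / 2"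
    by (auto simp: eventually_sequentially)
  have "block_approximable P Q n (?B k)"
    using A by (rule block_approximable_UN_le)
  then obtain m U where U: "measure P (sym_diff (?B k) (?C m U)) < \<eta> / 2"
    "measure Q (sym_diff (?B k) (?C m U)) < \<eta> / 2"
    using \<eta> unfolding block_approximable_def by (meson half_gt_zero order_refl)
  have "measure R (sym_diff (\<Union>i. A i) (?C m U)) \<le>
      measure R (sym_diff (\<Union>i. A i) (?B k)) + measure R (sym_diff (?B k) (?C m U))"
    if R: "prob_space R" "sets R = sets (coord_algebra UNIV)" for R
    using A(2) C R by (intro measure_sym_diff_le) auto
  from this[OF P] this[OF Q] k U
  have "measure P (sym_diff (\<Union>i. A i) (?C m U)) < \<eta>" "measure Q (sym_diff (\<Union>i. A i) (?C m U)) < \<eta>"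
    by linarith+
  then show "\<exists>m U. measure P (sym_diff (\<Union>i. A i) (?C m U)) < \<eta> \<and>
      measure Q (sym_diff (\<Union>i. A i) (?C m U)) < \<eta>"
    by blast
qed

text \<open>The approximable events include the generators and are closed under complements and
  countable unions, so induction over the generated sigma-algebra applies.\<close>

lemma block_approximable_future:
  assumes "A \<in> sets (coord_algebra {int n..})"
  shows "block_approximable P Q n A"
proof -
  have "A \<in> sigma_sets UNIV {{\<omega>. \<omega> i = a} | i a. i \<in> {int n..}}"
    using assms by (simp add: sets_coord_algebra)
  then show ?thesis
  proof induction
    case (Basic B)
    then show ?case
      using block_approximable_coord by auto
  next
    case Empty
    show ?case
      by (rule block_approximable_empty)
  next
    case (Compl B)
    then show ?case
      using block_approximable_Compl by (simp add: Compl_eq_Diff_UNIV)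
  next
    case (Union B)
    have "B i \<in> sets (coord_algebra UNIV)" for i
      using Union(1)[of i] coord_algebra_mono[of "{int n..}" UNIV] by (auto simp: sets_coord_algebra)
    then show ?case
      using Union(2) by (intro block_approximable_UN)
  qed
qed

end

subsection \<open>Dynamic uniqueness and affinities\<close>

text \<open>If every \<open>w\<close> in \<open>V\<close> left mass at least \<open>t\<close>
  outside \<open>U\<close>, the first block would lie in \<open>V\<close> and the second outside
  \<open>U\<close> with probability at least \<open>t\<close> times that of the first block event.
  But this joint event lies in the two symmetric differences with \<open>B\<close>, whose total
  probability is too small.\<close>

lemma exists_word_concentrated:
  assumes g: "prob_kernel g" and P: "is_path_law g x P"
    and B: "B \<in> sets (coord_algebra UNIV)" "0 < measure P B"
    and V: "V \<subseteq> words n" and U: "U \<subseteq> words m"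
    and t: "0 < t" "t \<le> 1" and \<eta>: "\<eta> \<le> t * measure P B / 4"
    and approx: "measure P (sym_diff B {\<omega>. block (int n) n \<omega> \<in> V}) < \<eta>"
      "measure P (sym_diff B {\<omega>. block (int (n + m)) m \<omega> \<in> U}) < \<eta>"
  shows "\<exists>w\<in>V. (\<Sum>v\<in>words m - U. word_prob g (concat_past w x) v) \<le> t"
proof (rule ccontr)
  assume "\<not> ?thesis"
  then have large: "t \<le> (\<Sum>v\<in>words m - U. word_prob g (concat_past w x) v)" if "w \<in> V" for w
    using that by force
  interpret prob_space P
    using P by (simp add: is_path_law_def)
  have sets: "sets P = sets (coord_algebra UNIV)"
    using P by (simp add: is_path_law_def)
  let ?C1 = "{\<omega>. block (int n) n \<omega> \<in> V}"
  let ?C2 = "{\<omega>. block (int (n + m)) m \<omega> \<in> U}"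
  have s: "B \<in> sets P" "?C1 \<in> sets P" "?C2 \<in> sets P"
    using B block_event[of _ _ UNIV] unfolding sets by auto
  have "measure P B \<le> measure P (?C1 \<union> sym_diff B ?C1)"
    using s by (intro finite_measure_mono) auto
  also have "\<dots> \<le> measure P ?C1 + measure P (sym_diff B ?C1)"
    using s by (intro measure_Un_le) auto
  finally have "measure P B - \<eta> \<le> measure P ?C1"
    using approx(1) by linarith
  moreover have "t * measure P B \<le> 1 * measure P B"
    using t(2) by (rule mult_right_mono) simp
  ultimately have C1: "3 * measure P B / 4 \<le> measure P ?C1"
    using \<eta> by linarith
  have "t * measure P ?C1 = (\<Sum>w\<in>V. word_prob g x w * t)"
    using measure_block[OF g P V] by (simp add: sum_distrib_left mult.commute)
  also have "\<dots> \<le> (\<Sum>w\<in>V. word_prob g x w * (\<Sum>v\<in>words m - U. word_prob g (concat_past w x) v))"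
    using large word_prob_nonneg[OF g] by (intro sum_mono mult_left_mono)
  also have "\<dots> = measure P {\<omega>. block (int n) n \<omega> \<in> V \<and> block (int (n + m)) m \<omega> \<in> words m - U}"
    using measure_two_blocks[OF g P V, of "words m - U" m] by simp
  also have "\<dots> \<le> measure P (sym_diff B ?C1 \<union> sym_diff B ?C2)"
    using s by (intro finite_measure_mono) auto
  also have "\<dots> \<le> measure P (sym_diff B ?C1) + measure P (sym_diff B ?C2)"
    using s by (intro measure_Un_le) auto
  also have "\<dots> < 2 * \<eta>"
    using approx by linarith
  also have "\<dots> \<le> t * measure P B / 2"
    using \<eta> by linarith
  also have "\<dots> < t * (3 * measure P B / 4)"
    using t(1) B(2) by (simp add: field_simps)
  also have "\<dots> \<le> t * measure P ?C1"
    using C1 t(1) by (intro mult_left_mono) auto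
  finally show False by simp
qed

theorem l2_criterion_imp_dynamic_uniqueness:
  assumes g: "prob_kernel g" and e: "0 < e" "\<And>a x. e \<le> g a x" and l2: "l2_criterion g"
  shows "dynamic_uniqueness g"
proof -
  obtain c where c: "0 < c" "\<And>n x y. c \<le> affinity g n x y"
    using affinity_bounded_below[OF g e l2] by blast
  have "c \<le> 1"
    using c(2)[of 0] by simp
  \<comment> \<open>Chosen so that the two error terms \<open>sqrt t\<close> of the testing bound
    add up to \<open>c / 2\<close>, below the lower bound \<open>c\<close>.\<close>
  define t where "t = (c / 4)\<^sup>2"
  have t: "0 < t" "t \<le> 1" "sqrt t = c / 4"
    using c(1) \<open>c \<le> 1\<close> by (auto simp: t_def power_le_one)
  have "measure (path_law g x) A \<le> measure (path_law g y) A" if A: "A \<in> tail_algebra" for A x y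
  proof (rule ccontr)
    let ?P = "path_law g x" and ?Q = "path_law g y"
    assume "\<not> measure ?P A \<le> measure ?Q A"
    have P: "is_path_law g x ?P" and Q: "is_path_law g y ?Q"
      using path_law_is_path_law[OF g] by auto
    interpret P: prob_space ?P
      using P by (simp add: is_path_law_def)
    interpret Q: prob_space ?Q
      using Q by (simp add: is_path_law_def)
    have sets: "sets ?P = sets (coord_algebra UNIV)" "sets ?Q = sets (coord_algebra UNIV)"
      using P Q by (auto simp: is_path_law_def)
    have space: "space ?Q = UNIV"
      using sets_eq_imp_space_eq[OF sets(2)] by simp
    note approx = block_approximable_future[OF P.prob_space_axioms sets(1) Q.prob_space_axioms sets(2)]
    have An: "A \<in> sets (coord_algebra {int n..})" if "1 \<le> n" for n
      using A that by (auto simp: tail_algebra_def)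
    have AU: "A \<in> sets (coord_algebra UNIV)"
      using An[of 1] coord_algebra_mono[of "{int 1..}" UNIV] by auto
    have A0: "A \<in> sets (coord_algebra {int 0..})"
      using An[of 1] coord_algebra_mono[of "{int 1..}" "{int 0..}"] by auto
    have "measure ?Q (- A) = 1 - measure ?Q A"
      using Q.prob_compl[of A] AU sets space by (simp add: Compl_eq_Diff_UNIV)
    then have pos: "0 < measure ?P A" "0 < measure ?Q (- A)"
      using \<open>\<not> measure ?P A \<le> measure ?Q A\<close> measure_nonneg[of ?Q A] P.prob_le_1[of A] by linarith+
    define \<eta> where "\<eta> = t * min (measure ?P A) (measure ?Q (- A)) / 4"
    have \<eta>: "0 < \<eta>" "\<eta> \<le> t * measure ?P A / 4" "\<eta> \<le> t * measure ?Q (- A) / 4"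
      using t pos by (auto simp: \<eta>_def intro!: mult_left_mono)
    obtain n0 where n0: "\<forall>n\<ge>n0. \<exists>V\<subseteq>words n.
        measure ?P (sym_diff A {\<omega>. block (int (0 + n)) n \<omega> \<in> V}) < \<eta> \<and>
        measure ?Q (sym_diff A {\<omega>. block (int (0 + n)) n \<omega> \<in> V}) < \<eta>"
      using approx[OF A0] \<eta>(1) unfolding block_approximable_def by blast
    \<comment> \<open>The first block runs from time \<open>0\<close> to \<open>n - 1\<close>, the
      second from time \<open>n\<close>. The maximum ensures \<open>1 \<le> n\<close>, from where on
      tail events are measurable.\<close>
    define n where "n = max n0 1"
    obtain V where V: "V \<subseteq> words n"
        "measure ?P (sym_diff A {\<omega>. block (int n) n \<omega> \<in> V}) < \<eta>"
        "measure ?Q (sym_diff A {\<omega>. block (int n) n \<omega> \<in> V}) < \<eta>"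
      using n0[rule_format, of n] by (auto simp: n_def)
    have n1: "1 \<le> n"
      by (simp add: n_def)
    obtain m U where U: "U \<subseteq> words m"
        "measure ?P (sym_diff A {\<omega>. block (int (n + m)) m \<omega> \<in> U}) < \<eta>"
        "measure ?Q (sym_diff A {\<omega>. block (int (n + m)) m \<omega> \<in> U}) < \<eta>"
      using approx[OF An[OF n1]] \<eta>(1) unfolding block_approximable_def by blast
    obtain w where w: "(\<Sum>v\<in>words m - U. word_prob g (concat_past w x) v) \<le> t"
      using exists_word_concentrated[OF g P AU pos(1) V(1) U(1) t(1,2) \<eta>(2) V(2) U(2)] by blast
    \<comment> \<open>Complements of block sets approximate \<open>- A\<close>, so the same
      \<open>U\<close> acts as the test for the continuations of both pasts.\<close>
    have "sym_diff (- A) {\<omega>. block (int n) n \<omega> \<in> words n - V} = sym_diff A {\<omega>. block (int n) n \<omega> \<in> V}"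
      "sym_diff (- A) {\<omega>. block (int (n + m)) m \<omega> \<in> words m - U} =
        sym_diff A {\<omega>. block (int (n + m)) m \<omega> \<in> U}"
      by auto
    moreover have "- A \<in> sets (coord_algebra UNIV)"
      using AU sets.compl_sets[of A "coord_algebra UNIV"] by (simp add: Compl_eq_Diff_UNIV)
    ultimately have "\<exists>w\<in>words n - V. (\<Sum>v\<in>words m - (words m - U). word_prob g (concat_past w y) v) \<le> t"
      using pos(2) t(1,2) \<eta>(3) V(3) U(3) by (intro exists_word_concentrated[OF g Q, where \<eta>=\<eta>]) auto
    moreover have "words m - (words m - U) = U"
      using U(1) by blast
    ultimately obtain w' where w': "(\<Sum>v\<in>U. word_prob g (concat_past w' y) v) \<le> t"
      by auto
    have "c \<le> affinity g m (concat_past w x) (concat_past w' y)"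
      by (rule c(2))
    also have "\<dots> \<le> sqrt t + sqrt t"
      by (rule order_trans[OF affinity_le_tests[OF g U(1)]])
        (intro add_mono iffD2[OF real_sqrt_le_iff] w w')
    also have "\<dots> = c / 2"
      by (simp add: t)
    finally show False
      using c(1) by simp
  qed
  then show ?thesis
    unfolding dynamic_uniqueness_def by (meson order_antisym)
qed

section \<open>Separating tail events from vanishing affinities\<close>

lemma sqrt_sum_le_sum_sqrt:
  assumes "\<And>i. i \<in> A \<Longrightarrow> 0 \<le> f i"
  shows "sqrt (sum f A) \<le> (\<Sum>i\<in>A. sqrt (f i))"
  using L2_set_le_sum[of A "\<lambda>i. sqrt (f i)"] assms by (simp add: L2_set_def)

text \<open>The law of the \<open>m\<close> symbols from time \<open>n\<close> on is a mixture over
  the first \<open>n\<close> symbols. The affinity of two mixtures is at most the sum of the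
  affinities of their components, and the likelihood-ratio test has total error at most the
  affinity.\<close>

lemma separating_words:
  assumes g: "prob_kernel g" and P: "is_path_law g x P" and Q: "is_path_law g y Q"
  shows "\<exists>U\<subseteq>words m.
    measure P {\<omega>. block (int (n + m)) m \<omega> \<in> words m - U} + measure Q {\<omega>. block (int (n + m)) m \<omega> \<in> U} \<le>
    (\<Sum>w\<in>words n. \<Sum>w'\<in>words n. affinity g m (concat_past w x) (concat_past w' y))"
proof -
  \<comment> \<open>For \<open>v\<close> of length \<open>m\<close>, the probability from the past
    \<open>z\<close> that the symbols at times \<open>n\<close> to \<open>n + m - 1\<close> form
    \<open>v\<close>.\<close>
  define \<mu> where "\<mu> z v = (\<Sum>w\<in>words n. word_prob g z w * word_prob g (concat_past w z) v)" for z v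
  have nn: "0 \<le> \<mu> z v" for z v
    unfolding \<mu>_def using word_prob_nonneg[OF g] by (intro sum_nonneg mult_nonneg_nonneg)
  have meas: "measure R {\<omega>. block (int (n + m)) m \<omega> \<in> W} = (\<Sum>v\<in>W. \<mu> z v)"
    if "is_path_law g z R" "W \<subseteq> words m" for R z W
    using measure_two_blocks[OF g that(1) order_refl that(2), of n]
    by (simp add: \<mu>_def sum_distrib_left sum.swap[of _ W])
  have split: "sqrt (\<mu> x v * \<mu> y v) \<le> (\<Sum>w\<in>words n. \<Sum>w'\<in>words n.
      sqrt (word_prob g (concat_past w x) v * word_prob g (concat_past w' y) v))" for v
  proof -
    let ?p = "\<lambda>w. word_prob g x w * word_prob g (concat_past w x) v"
    let ?q = "\<lambda>w'. word_prob g y w' * word_prob g (concat_past w' y) v"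
    have pos: "0 \<le> ?p w" "0 \<le> ?q w" for w
      using word_prob_nonneg[OF g] by auto
    have le: "?p w \<le> word_prob g (concat_past w x) v" "?q w \<le> word_prob g (concat_past w y) v" for w
      using word_prob_nonneg[OF g] word_prob_le_1[OF g] by (auto intro: mult_right_le_one_le mult_left_le_one_le)
    have "sqrt (\<mu> x v * \<mu> y v) = sqrt (\<Sum>w\<in>words n. \<Sum>w'\<in>words n. ?p w * ?q w')"
      by (simp add: \<mu>_def sum_product)
    also have "\<dots> \<le> (\<Sum>w\<in>words n. sqrt (\<Sum>w'\<in>words n. ?p w * ?q w'))"
      by (intro sqrt_sum_le_sum_sqrt sum_nonneg mult_nonneg_nonneg[OF pos])
    also have "\<dots> \<le> (\<Sum>w\<in>words n. \<Sum>w'\<in>words n. sqrt (?p w * ?q w'))"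
      by (intro sum_mono sqrt_sum_le_sum_sqrt mult_nonneg_nonneg[OF pos])
    \<comment> \<open>The weights of \<open>w\<close> and \<open>w'\<close> are bounded by
      \<open>1\<close>. For fixed \<open>n\<close> the sums remain finite, so they still tend to
      \<open>0\<close> whenever all their affinities do.\<close>
    also have "\<dots> \<le> (\<Sum>w\<in>words n. \<Sum>w'\<in>words n.
        sqrt (word_prob g (concat_past w x) v * word_prob g (concat_past w' y) v))"
      by (intro sum_mono real_sqrt_le_mono mult_mono le pos word_prob_nonneg[OF g])
    finally show ?thesis .
  qed
  \<comment> \<open>The likelihood-ratio test: on each word the smaller of the two probabilities is
    at most their geometric mean.\<close>
  define U where "U = {v \<in> words m. \<mu> y v < \<mu> x v}"
  have U: "U \<subseteq> words m"
    by (auto simp: U_def)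
  have le: "\<mu> x v \<le> sqrt (\<mu> x v * \<mu> y v)" if "v \<in> words m - U" for v
    using that nn by (intro real_le_rsqrt) (auto simp: U_def power2_eq_square intro!: mult_left_mono)
  have le': "\<mu> y v \<le> sqrt (\<mu> x v * \<mu> y v)" if "v \<in> U" for v
    using that nn by (intro real_le_rsqrt) (auto simp: U_def power2_eq_square intro!: mult_right_mono)
  have "measure P {\<omega>. block (int (n + m)) m \<omega> \<in> words m - U} + measure Q {\<omega>. block (int (n + m)) m \<omega> \<in> U}
      = (\<Sum>v\<in>words m - U. \<mu> x v) + (\<Sum>v\<in>U. \<mu> y v)"
    using meas[OF P, of "words m - U"] meas[OF Q U] by simp
  also have "\<dots> \<le> (\<Sum>v\<in>words m - U. sqrt (\<mu> x v * \<mu> y v)) + (\<Sum>v\<in>U. sqrt (\<mu> x v * \<mu> y v))"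
    using le le' by (intro add_mono sum_mono)
  also have "\<dots> = (\<Sum>v\<in>words m. sqrt (\<mu> x v * \<mu> y v))"
    by (rule sum.subset_diff[OF U finite_words, symmetric])
  also have "\<dots> \<le> (\<Sum>v\<in>words m. \<Sum>w\<in>words n. \<Sum>w'\<in>words n.
      sqrt (word_prob g (concat_past w x) v * word_prob g (concat_past w' y) v))"
    by (intro sum_mono split)
  also have "\<dots> = (\<Sum>w\<in>words n. \<Sum>w'\<in>words n. affinity g m (concat_past w x) (concat_past w' y))"
    unfolding affinity_def
    by (subst sum.swap) (intro sum.cong refl sum.swap)
  finally show ?thesis
    using U by blast
qed

lemma limsup_in_tail_algebra:
  assumes "\<And>n. A n \<in> sets (coord_algebra {int n..})"
  shows "limsup A \<in> tail_algebra"
  unfolding tail_algebra_def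
proof
  fix k :: int
  \<comment> \<open>Initial terms do not affect a limsup, so only events in the future of
    \<open>k\<close> need to enter.\<close>
  have "limsup A = (\<Inter>N\<in>{nat k..}. \<Union>n\<in>{N..}. A n)"
    unfolding limsup_INF_SUP
  proof (intro equalityI subsetI)
    fix \<omega> assume "\<omega> \<in> (\<Inter>N\<in>{nat k..}. \<Union>n\<in>{N..}. A n)"
    then have "\<omega> \<in> (\<Union>n\<in>{max N (nat k)..}. A n)" for N
      by (metis INT_E atLeast_iff max.cobounded2)
    then show "\<omega> \<in> (\<Inter>N. \<Union>n\<in>{N..}. A n)"
      by fastforce
  qed auto
  also have "\<dots> \<in> sets (coord_algebra {k..})"
  proof (intro sets.countable_INT'' sets.countable_INT' sets.countable_UN'')
    fix N n assume "N \<in> {nat k..}" "n \<in> {N..}"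
    then have "{int n..} \<subseteq> {k..}"
      by auto
    then show "A n \<in> sets (coord_algebra {k..})"
      using assms[of n] coord_algebra_mono by blast
  qed (use sets.top[of "coord_algebra {k..}"] in auto)
  finally show "limsup A \<in> sets (coord_algebra {k..})" .
qed

text \<open>For each \<open>n\<close> there is an event in the future of \<open>n\<close> that is
  nearly certain from \<open>x\<close> and nearly impossible from \<open>y\<close>; Borel-Cantelli
  makes the limsup of these events certain from \<open>x\<close> and null from \<open>y\<close>. The
  assumption covers all continuations of length \<open>n\<close> because such an event does not
  reveal the first \<open>n\<close> symbols.\<close>

theorem not_dynamic_uniquenessI:
  assumes g: "prob_kernel g"
    and aff: "\<And>n w w'. \<lbrakk>w \<in> words n; w' \<in> words n\<rbrakk> \<Longrightarrow>
      (\<lambda>m. affinity g m (concat_past w x) (concat_past w' y)) \<longlonglongrightarrow> 0"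
  shows "\<not> dynamic_uniqueness g"
proof
  assume unique: "dynamic_uniqueness g"
  let ?P = "path_law g x" and ?Q = "path_law g y"
  have P: "is_path_law g x ?P" and Q: "is_path_law g y ?Q"
    using path_law_is_path_law[OF g] by auto
  interpret P: prob_space ?P
    using P by (simp add: is_path_law_def)
  interpret Q: prob_space ?Q
    using Q by (simp add: is_path_law_def)
  have sets: "sets ?P = sets (coord_algebra UNIV)" "sets ?Q = sets (coord_algebra UNIV)"
    using P Q by (auto simp: is_path_law_def)
  have space: "space ?P = UNIV"
    using sets_eq_imp_space_eq[OF sets(1)] by simp
  \<comment> \<open>The geometric bound makes both error probabilities summable in
    \<open>n\<close>.\<close>
  have "\<exists>A\<in>sets (coord_algebra {int n..}). measure ?P (- A) + measure ?Q A \<le> (1 / 2) ^ n" for n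
  proof -
    have "(\<lambda>m. \<Sum>w\<in>words n. \<Sum>w'\<in>words n. affinity g m (concat_past w x) (concat_past w' y)) \<longlonglongrightarrow>
        (\<Sum>w\<in>words n. \<Sum>w'\<in>words n. 0)"
      by (intro tendsto_sum aff)
    then have "(\<lambda>m. \<Sum>w\<in>words n. \<Sum>w'\<in>words n. affinity g m (concat_past w x) (concat_past w' y)) \<longlonglongrightarrow> 0"
      by simp
    from order_tendstoD(2)[OF this, of "(1 / 2) ^ n"]
    obtain m where m: "(\<Sum>w\<in>words n. \<Sum>w'\<in>words n. affinity g m (concat_past w x) (concat_past w' y)) < (1 / 2) ^ n"
      by (auto simp: eventually_sequentially)
    from separating_words[OF g P Q, of m n]
    obtain U where U: "U \<subseteq> words m" "measure ?P {\<omega>. block (int (n + m)) m \<omega> \<in> words m - U} +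
        measure ?Q {\<omega>. block (int (n + m)) m \<omega> \<in> U} \<le>
        (\<Sum>w\<in>words n. \<Sum>w'\<in>words n. affinity g m (concat_past w x) (concat_past w' y))"
      by blast
    have "{\<omega>. block (int (n + m)) m \<omega> \<in> words m - U} = - {\<omega>. block (int (n + m)) m \<omega> \<in> U}"
      by auto
    then have "measure ?P (- {\<omega>. block (int (n + m)) m \<omega> \<in> U}) + measure ?Q {\<omega>. block (int (n + m)) m \<omega> \<in> U} \<le> (1 / 2) ^ n"
      using U m by simp
    moreover have "{\<omega>. block (int (n + m)) m \<omega> \<in> U} \<in> sets (coord_algebra {int n..})"
      by (rule block_event) auto
    ultimately show ?thesis by blast
  qed
  then obtain A where A: "\<And>n. A n \<in> sets (coord_algebra {int n..})"
    "\<And>n. measure ?P (- A n) + measure ?Q (A n) \<le> (1 / 2) ^ n"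
    by metis
  have AU: "A n \<in> sets (coord_algebra UNIV)" for n
    using A(1)[of n] coord_algebra_mono[of "{int n..}" UNIV] by auto
  then have cAU: "- A n \<in> sets (coord_algebra UNIV)" for n
    using sets.compl_sets[of "A n" "coord_algebra UNIV"] by (simp add: Compl_eq_Diff_UNIV)
  have geo: "summable (\<lambda>n. (1 / 2 :: real) ^ n)"
    by (rule summable_geometric) simp
  have le: "measure ?P (- A n) \<le> (1 / 2) ^ n" "measure ?Q (A n) \<le> (1 / 2) ^ n" for n
    using A(2)[of n] measure_nonneg[of ?P "- A n"] measure_nonneg[of ?Q "A n"] by linarith+
  have "summable (\<lambda>n. measure ?Q (A n))"
    using le by (intro summable_comparison_test'[OF geo, where N=0]) simp
  then have "limsup A \<in> null_sets ?Q"
    using AU sets by (intro borel_cantelli_limsup1) (auto simp: Q.emeasure_eq_measure)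
  then have "measure ?Q (limsup A) = 0"
    by (auto simp: null_sets_def measure_def)
  moreover have "measure ?P (limsup A) = 1"
  proof -
    have "summable (\<lambda>n. measure ?P (- A n))"
      using le by (intro summable_comparison_test'[OF geo, where N=0]) simp
    \<comment> \<open>More than membership in the limsup: almost every path lies in all but finitely
      many \<open>A n\<close>.\<close>
    then have "AE \<omega> in ?P. \<forall>\<^sub>F n in sequentially. \<omega> \<in> space ?P - (- A n)"
      using cAU sets by (intro borel_cantelli_AE1) (auto simp: P.emeasure_eq_measure)
    then have "AE \<omega> in ?P. \<omega> \<in> limsup A"
    proof eventually_elim
      case (elim \<omega>)
      then obtain N where N: "\<And>n. N \<le> n \<Longrightarrow> \<omega> \<in> A n"
        by (auto simp: eventually_sequentially)
      have "\<omega> \<in> (\<Union>n\<in>{M..}. A n)" for M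
        using N[of "max M N"] by (intro UN_I[of "max M N"]) auto
      then show ?case
        unfolding limsup_INF_SUP by blast
    qed
    moreover have "limsup A \<in> sets ?P"
    proof -
      have "limsup A \<in> sets (coord_algebra {1..})"
        using limsup_in_tail_algebra[OF A(1)] by (auto simp: tail_algebra_def)
      then show ?thesis
        using coord_algebra_mono[of "{1..}" UNIV] sets by auto
    qed
    ultimately show ?thesis
      by (simp add: P.prob_eq_1)
  qed
  moreover have "measure ?P (limsup A) = measure ?Q (limsup A)"
    using unique limsup_in_tail_algebra[OF A(1)] unfolding dynamic_uniqueness_def by blast
  ultimately show False by simp
qed

section \<open>Concatenated pasts and square-summable sequences\<close>

lemma concat_past_agree:
  assumes "u \<in> words k" "l < k"
  shows "concat_past u x l = concat_past u y l"
  using assms by (simp add: concat_past_def words_def)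

lemma concat_past_const:
  assumes "u \<in> words k" "w \<in> words n" "k + n \<le> l"
  shows "concat_past u (concat_past w (\<lambda>_. a)) l = a"
  using assms by (auto simp: concat_past_def words_def)

lemma summable_power2_nonneg:
  fixes f :: "nat \<Rightarrow> real"
  assumes "summable f" "\<And>n. 0 \<le> f n"
  shows "summable (\<lambda>n. (f n)\<^sup>2)"
proof (rule summable_comparison_test_ev[OF _ assms(1)])
  have "\<forall>\<^sub>F n in sequentially. f n < 1"
    using summable_LIMSEQ_zero[OF assms(1)] by (rule order_tendstoD) simp
  then show "\<forall>\<^sub>F n in sequentially. norm ((f n)\<^sup>2) \<le> f n"
  proof eventually_elim
    case (elim n)
    then show ?case
      using mult_right_mono[of "f n" 1 "f n"] assms(2)[of n] by (simp add: power2_eq_square)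
  qed
qed

text \<open>In each group of \<open>c\<close> consecutive indices the first term is the largest, so
  \<open>c\<close> times the sampled series bounds the full one.\<close>

lemma summable_power2_subsampled:
  fixes f :: "nat \<Rightarrow> real"
  assumes f: "antimono f" "\<And>k. 0 \<le> f k" and c: "0 < c"
    and summ: "summable (\<lambda>k. (f (c * (k + n)))\<^sup>2)"
  shows "summable (\<lambda>k. (f k)\<^sup>2)"
proof -
  have S: "summable (\<lambda>k. (f (k * c))\<^sup>2)"
    using summ summable_iff_shift[of "\<lambda>k. (f (k * c))\<^sup>2" n] by (simp add: mult.commute)
  show ?thesis
  proof (rule bounded_imp_summable[where B="real c * (\<Sum>k. (f (k * c))\<^sup>2)"])
    fix N
    have "N < Suc N * c"
      using c by (cases c) auto
    then have "(\<Sum>i\<le>N. (f i)\<^sup>2) \<le> (\<Sum>i<Suc N * c. (f i)\<^sup>2)"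
      by (intro sum_mono2) auto
    also have "\<dots> = (\<Sum>j<Suc N. \<Sum>i\<in>{j * c..<j * c + c}. (f i)\<^sup>2)"
      by (rule sum.nat_group[symmetric])
    also have "\<dots> \<le> (\<Sum>j<Suc N. \<Sum>i\<in>{j * c..<j * c + c}. (f (j * c))\<^sup>2)"
      using f by (intro sum_mono power_mono) (auto dest: antimonoD)
    also have "\<dots> = real c * (\<Sum>j<Suc N. (f (j * c))\<^sup>2)"
      unfolding sum_distrib_left by (intro sum.cong refl) simp
    also have "\<dots> \<le> real c * (\<Sum>k. (f (k * c))\<^sup>2)"
      by (intro mult_left_mono sum_le_suminf S) auto
    finally show "(\<Sum>i\<le>N. (f i)\<^sup>2) \<le> real c * (\<Sum>k. (f (k * c))\<^sup>2)" .
  qed simp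
qed

lemma l2_criterionI:
  assumes g: "prob_kernel g" and le: "\<And>k. variation k g \<le> f k" and f: "summable (\<lambda>k. (f k)\<^sup>2)"
  shows "l2_criterion g"
proof -
  have "norm ((variation k g)\<^sup>2) \<le> (f k)\<^sup>2" for k
    using power_mono[OF le variation_nonneg[OF g], of k 2] by simp
  then have "summable (\<lambda>k. (variation k g)\<^sup>2)"
    by (rule summable_comparison_test'[OF f, where N=0])
  then show ?thesis
    unfolding l2_criterion_def by (subst summable_Suc_iff)
qed

text \<open>At most \<open>q\<close> terms fall below \<open>1\<close>, each by at most
  \<open>2\<close>.\<close>

lemma sum_ge_of_eventually_one:
  fixes f :: "nat \<Rightarrow> real"
  assumes "\<And>l. - 1 \<le> f l" "\<And>l. q \<le> l \<Longrightarrow> f l = 1"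
  shows "real M - 2 * real q \<le> (\<Sum>l<M. f l)"
proof -
  \<comment> \<open>The second conjunct carries the induction as long as
    \<open>M < q\<close>.\<close>
  have "real M - 2 * real q \<le> (\<Sum>l<M. f l) \<and> - real M \<le> (\<Sum>l<M. f l)"
  proof (induction M)
    case (Suc M)
    show ?case
      using Suc assms(1)[of M] assms(2)[of M] by (cases "q \<le> M") auto
  qed simp
  then show ?thesis ..
qed

lemma spin_val_bounds: "- 1 \<le> spin_val a" "spin_val a \<le> 1"
  by (cases a; simp)+

subsection \<open>Bramson--Kalikow--Friedli kernels\<close>

locale bkf =
  fixes eps m lam psi
  assumes model: "bkf_model eps m lam psi"
begin

definition avg :: "nat \<Rightarrow> past \<Rightarrow> real" where
  "avg j z = (\<Sum>l<m (Suc j). spin_val (z l)) / real (m (Suc j))"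

text \<open>The total weight of the windows reaching beyond the last \<open>k\<close> symbols. It
  stands in for the variation rate: it bounds it from above and, at a larger argument and up to an
  error, bounds kernel differences from below.\<close>

definition weight_above :: "nat \<Rightarrow> real" where
  "weight_above k = (\<Sum>j. lam (Suc j) * of_bool (k < m (Suc j)))"

lemma is_prob_kernel: "prob_kernel (bkf_kernel m lam psi)"
  using model by (rule prob_kernel_bkf)

lemma eps_pos: "0 < eps"
  and lam_pos: "0 < lam (Suc j)"
  and lam_sums: "(\<lambda>j. lam (Suc j)) sums 1"
  and psi_range: "r \<in> {-1..1} \<Longrightarrow> eps \<le> psi r" "r \<in> {-1..1} \<Longrightarrow> psi r \<le> 1 - eps"
  and psi_mono: "mono_on {-1..1} psi"
  using model by (auto simp: bkf_model_def)

lemma m_pos: "0 < m (Suc j)"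
proof -
  have "odd (m (Suc j))"
    using model by (auto simp: bkf_model_def)
  then show ?thesis
    by (auto intro: Nat.gr0I)
qed

lemma abs_avg: "\<bar>avg j z\<bar> \<le> 1"
proof -
  have "\<bar>\<Sum>l<m (Suc j). spin_val (z l)\<bar> \<le> (\<Sum>l<m (Suc j). \<bar>spin_val (z l)\<bar>)"
    by (rule sum_abs)
  then show ?thesis
    using m_pos[of j] by (simp add: avg_def)
qed

lemma avg_range: "spin_val a * avg j z \<in> {-1..1}" "avg j z \<in> {-1..1}"
  using abs_avg[of j z] by (cases a; auto simp: abs_le_iff)+

lemma summable_lam_bounded:
  assumes "\<And>j. \<bar>f j\<bar> \<le> 1"
  shows "summable (\<lambda>j. lam (Suc j) * f j)"
proof (rule summable_comparison_test'[OF sums_summable[OF lam_sums], where N=0])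
  fix j
  show "norm (lam (Suc j) * f j) \<le> lam (Suc j)"
    using assms[of j] lam_pos[of j] by (simp add: abs_mult mult_left_le)
qed

lemma suminf_lam: "(\<Sum>j. lam (Suc j) * c) = c"
  using sums_mult2[OF lam_sums, of c] by (simp add: sums_iff)

lemma kernel_eq: "bkf_kernel m lam psi a z = (\<Sum>j. lam (Suc j) * psi (spin_val a * avg j z))"
  by (simp add: bkf_kernel_def avg_def)

lemma abs_psi: "\<bar>psi (spin_val a * avg j z)\<bar> \<le> 1"
  using psi_range[OF avg_range(1)[of a j z]] eps_pos by simp

lemma eps_le_kernel: "eps \<le> bkf_kernel m lam psi a z"
proof -
  have "eps < 1"
    using model by (auto simp: bkf_model_def)
  have "(\<Sum>j. lam (Suc j) * eps) \<le> bkf_kernel m lam psi a z"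
    unfolding kernel_eq using eps_pos \<open>eps < 1\<close> abs_psi lam_pos psi_range(1)[OF avg_range(1)]
    by (intro suminf_le mult_left_mono summable_lam_bounded) (auto intro: less_imp_le)
  then show ?thesis
    by (simp add: suminf_lam)
qed

lemma abs_psi_diff: "\<bar>psi (spin_val a * avg j z) - psi (spin_val a * avg j z')\<bar> \<le> 1"
  using psi_range[OF avg_range(1)[of a j z]] psi_range[OF avg_range(1)[of a j z']] eps_pos
  by linarith

lemma kernel_diff: "bkf_kernel m lam psi a z - bkf_kernel m lam psi a z' =
    (\<Sum>j. lam (Suc j) * (psi (spin_val a * avg j z) - psi (spin_val a * avg j z')))"
  unfolding kernel_eq
  by (subst suminf_diff) (auto intro!: summable_lam_bounded abs_psi simp: right_diff_distrib)

lemma avg_cong: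
  assumes "\<And>l. l < m (Suc j) \<Longrightarrow> z l = z' l"
  shows "avg j z = avg j z'"
  using assms by (simp add: avg_def)

text \<open>Windows of length at most \<open>k\<close> see the same symbols and cancel; each other
  window contributes at most its weight.\<close>

lemma variation_le_weight_above: "variation k (bkf_kernel m lam psi) \<le> weight_above k"
proof (rule variation_le)
  fix a :: spin and w :: "spin list" and x y :: past assume w: "length w = k"
  let ?z = "concat_past w x" and ?z' = "concat_past w y"
  let ?d = "\<lambda>j. lam (Suc j) * (psi (spin_val a * avg j ?z) - psi (spin_val a * avg j ?z'))"
  have d: "\<bar>?d j\<bar> \<le> lam (Suc j) * of_bool (k < m (Suc j))" for j
  proof (cases "k < m (Suc j)")
    case True
    then show ?thesis
      using abs_psi_diff[of a j ?z ?z'] lam_pos[of j] by (simp add: abs_mult mult_left_le)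
  next
    case False
    then have "avg j ?z = avg j ?z'"
      using w by (intro avg_cong concat_past_agree[of _ k]) (auto simp: words_def)
    then show ?thesis
      using lam_pos[of j] by simp
  qed
  have s: "summable (\<lambda>j. lam (Suc j) * of_bool (k < m (Suc j)))"
    by (intro summable_lam_bounded) auto
  have "\<bar>\<Sum>j. ?d j\<bar> \<le> (\<Sum>j. lam (Suc j) * of_bool (k < m (Suc j)))"
    using norm_suminf_le[of ?d, OF _ s] d by simp
  then show "\<bar>bkf_kernel m lam psi a ?z - bkf_kernel m lam psi a ?z'\<bar> \<le> weight_above k"
    by (simp add: kernel_diff weight_above_def)
qed

lemma weight_above_nonneg: "0 \<le> weight_above k"
  unfolding weight_above_def using lam_pos
  by (intro suminf_nonneg summable_lam_bounded) (auto intro: less_imp_le)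

lemma antimono_weight_above: "antimono weight_above"
  unfolding weight_above_def using lam_pos
  by (intro antimonoI suminf_le mult_left_mono summable_lam_bounded) (auto intro: less_imp_le)

text \<open>Exchange the sums: a window of length \<open>M\<close> is counted only for
  \<open>k\<close> among the \<open>d\<close> numbers preceding \<open>M\<close>, so each weight
  enters at most \<open>d\<close> times.\<close>

lemma summable_weight_window:
  "summable (\<lambda>k. (\<Sum>j. lam (Suc j) * of_bool (k < m (Suc j) \<and> m (Suc j) < k + d)))"
    (is "summable (\<lambda>k. \<Sum>j. ?e k j)")
proof (rule bounded_imp_summable[where B="real d"])
  have s: "summable (\<lambda>j. ?e k j)" for k
    by (intro summable_lam_bounded) auto
  show "0 \<le> (\<Sum>j. ?e k j)" for k
    using lam_pos by (intro suminf_nonneg s) (auto intro: less_imp_le)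
  fix N
  have count: "(\<Sum>k\<le>N. of_bool (k < M \<and> M < k + d)) \<le> real d" for M
  proof -
    have "{..N} \<inter> {k. k < M \<and> M < k + d} \<subseteq> {M - d..<M}"
      by auto
    from card_mono[OF _ this] have "card ({..N} \<inter> {k. k < M \<and> M < k + d}) \<le> d"
      by simp
    then show ?thesis
      by simp
  qed
  have "(\<Sum>k\<le>N. \<Sum>j. ?e k j) = (\<Sum>j. \<Sum>k\<le>N. ?e k j)"
    by (rule suminf_sum[symmetric, OF s])
  also have "\<dots> \<le> (\<Sum>j. lam (Suc j) * real d)"
  proof (rule suminf_le)
    show "(\<Sum>k\<le>N. ?e k j) \<le> lam (Suc j) * real d" for j
      unfolding sum_distrib_left[symmetric]
      using count lam_pos[of j] by (intro mult_left_mono) auto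
    show "summable (\<lambda>j. \<Sum>k\<le>N. ?e k j)"
      by (intro summable_sum s)
    show "summable (\<lambda>j. lam (Suc j) * real d)"
      by (intro summable_mult2 sums_summable[OF lam_sums])
  qed
  finally show "(\<Sum>k\<le>N. \<Sum>j. ?e k j) \<le> real d"
    by (simp add: suminf_lam)
qed

text \<open>
  Averages over windows shorter than \<open>k\<close> do not see the difference of the pasts, and windows of length
  at least \<open>k + 2 * n\<close> see more of the constant pasts than of \<open>w\<close> and \<open>w'\<close>. In between the sign of the
  difference is not controlled.
\<close>

lemma psi_avg_diff_ge:
  assumes r0: "0 \<le> r0" "r0 < 1" "psi (- r0) < psi r0" and c: "2 \<le> real c * (1 - r0)"
    and u: "u \<in> words k" and w: "w \<in> words n" "w' \<in> words n"
  defines "z \<equiv> concat_past u (concat_past w (\<lambda>_. Plus))"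
    and "z' \<equiv> concat_past u (concat_past w' (\<lambda>_. Minus))"
  shows "(psi r0 - psi (- r0)) * of_bool (c * (k + n) < m (Suc j)) -
      of_bool (k < m (Suc j) \<and> m (Suc j) < k + 2 * n) \<le> psi (avg j z) - psi (avg j z')"
proof -
  let ?M = "m (Suc j)"
  have M: "0 < real ?M"
    using m_pos[of j] by simp
  have psi_le: "psi (avg j z') \<le> psi (avg j z)" if "avg j z' \<le> avg j z"
    using that avg_range(2) by (intro mono_onD[OF psi_mono]) auto
  have mono: "psi (avg j z') \<le> psi (avg j z)" if "k + 2 * n \<le> ?M \<or> ?M \<le> k"
  proof (rule psi_le)
    \<comment> \<open>The halved difference has values in \<open>{-1..1}\<close>, vanishes on the
      first \<open>k\<close> positions and is \<open>1\<close> from position \<open>k + n\<close>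
      on, so only \<open>n\<close> positions can count negatively.\<close>
    let ?f = "\<lambda>l. (spin_val (z l) - spin_val (z' l)) / 2"
    have "0 \<le> (\<Sum>l<?M. ?f l)"
      using that
    proof
      assume "k + 2 * n \<le> ?M"
      then obtain M' where M': "?M = k + M'" "2 * n \<le> M'"
        by (metis add_le_cancel_left le_Suc_ex le_trans le_add1)
      have "(\<Sum>l<?M. ?f l) = (\<Sum>l<k. ?f l) + (\<Sum>l<M'. ?f (k + l))"
        unfolding M'(1) by (induction M') auto
      also have "(\<Sum>l<k. ?f l) = 0"
        unfolding z_def z'_def
        by (intro sum.neutral ballI) (metis concat_past_agree[OF u] diff_self div_0 lessThan_iff)
      also have "0 + (\<Sum>l<M'. ?f (k + l)) \<ge> real M' - 2 * real n"
      proof -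
        have "- 1 \<le> ?f l" for l
          using spin_val_bounds(1)[of "z l"] spin_val_bounds(2)[of "z' l"] by simp
        moreover have "?f (k + l) = 1" if "n \<le> l" for l
          using that by (simp add: z_def z'_def concat_past_const[OF u w(1)] concat_past_const[OF u w(2)])
        ultimately show ?thesis
          by (simp add: sum_ge_of_eventually_one)
      qed
      finally show ?thesis
        using M'(2) by linarith
    next
      assume "?M \<le> k"
      then have "z l = z' l" if "l < ?M" for l
        using that concat_past_agree[OF u, of l] by (simp add: z_def z'_def)
      then show ?thesis
        by simp
    qed
    then show "avg j z' \<le> avg j z"
      using M by (simp add: avg_def sum_subtractf sum_divide_distrib[symmetric] divide_right_mono)
  qed
  show ?thesis
  proof (cases "c * (k + n) < ?M")
    case True
    then have "real c * real (k + n) \<le> real ?M"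
      by (metis less_imp_le of_nat_le_iff of_nat_mult)
    \<comment> \<open>At most \<open>k + n\<close> symbols of the window come from outside the
      constant past, which a window this long tolerates while keeping its average at distance at
      least \<open>r0\<close> from \<open>0\<close> on the favourable side.\<close>
    then have "(1 - r0) * (real c * real (k + n)) \<le> (1 - r0) * real ?M"
      using r0 by (intro mult_left_mono) auto
    moreover have "2 * real (k + n) \<le> (real c * (1 - r0)) * real (k + n)"
      using c by (intro mult_right_mono) auto
    ultimately have le: "r0 * real ?M \<le> real ?M - 2 * real (k + n)"
      by (simp add: algebra_simps)
    have "real ?M - 2 * real (k + n) \<le> (\<Sum>l<?M. spin_val (z l))"
      using concat_past_const[OF u w(1)] spin_val_bounds(1)
      by (intro sum_ge_of_eventually_one) (simp_all add: z_def)
    with le have "r0 \<le> avg j z"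
      using M by (simp add: avg_def field_simps)
    moreover have "real ?M - 2 * real (k + n) \<le> (\<Sum>l<?M. - spin_val (z' l))"
      using concat_past_const[OF u w(2)] spin_val_bounds(2)
      by (intro sum_ge_of_eventually_one) (simp_all add: z'_def)
    with le have "avg j z' \<le> - r0"
      using M by (simp add: avg_def field_simps sum_negf)
    ultimately have "psi r0 \<le> psi (avg j z)" "psi (avg j z') \<le> psi (- r0)"
      using r0 avg_range(2) by (auto intro!: mono_onD[OF psi_mono])
    then show ?thesis
      using True by (auto simp: of_bool_def)
  next
    \<comment> \<open>No gain is claimed; where the sign is uncontrolled, the loss is at most
      \<open>1\<close>, which the error term absorbs.\<close>
    case False
    then show ?thesis
      using mono abs_psi_diff[of Plus j z z'] by (auto simp: of_bool_def not_less)
  qed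
qed

text \<open>The bound for single windows is averaged with the weights \<open>lam\<close>. For fixed
  \<open>n\<close> the resulting error is summable in \<open>k\<close>.\<close>

lemma kernel_diff_ge:
  assumes r0: "0 \<le> r0" "r0 < 1" "psi (- r0) < psi r0" and c: "2 \<le> real c * (1 - r0)"
    and u: "u \<in> words k" and w: "w \<in> words n" "w' \<in> words n"
  shows "(psi r0 - psi (- r0)) * weight_above (c * (k + n)) -
      (\<Sum>j. lam (Suc j) * of_bool (k < m (Suc j) \<and> m (Suc j) < k + 2 * n))
    \<le> bkf_kernel m lam psi Plus (concat_past u (concat_past w (\<lambda>_. Plus))) -
      bkf_kernel m lam psi Plus (concat_past u (concat_past w' (\<lambda>_. Minus)))"
proof -
  let ?z = "concat_past u (concat_past w (\<lambda>_. Plus))"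
  let ?z' = "concat_past u (concat_past w' (\<lambda>_. Minus))"
  let ?\<kappa> = "psi r0 - psi (- r0)"
  let ?A = "\<lambda>j. of_bool (c * (k + n) < m (Suc j)) :: real"
  let ?E = "\<lambda>j. of_bool (k < m (Suc j) \<and> m (Suc j) < k + 2 * n) :: real"
  have sA: "summable (\<lambda>j. lam (Suc j) * ?A j)" and sE: "summable (\<lambda>j. lam (Suc j) * ?E j)"
    by (intro summable_lam_bounded; simp)+
  have "?\<kappa> * weight_above (c * (k + n)) - (\<Sum>j. lam (Suc j) * ?E j) =
      (\<Sum>j. ?\<kappa> * (lam (Suc j) * ?A j) - lam (Suc j) * ?E j)"
    unfolding weight_above_def
    by (simp add: suminf_diff[OF summable_mult[OF sA] sE, symmetric] suminf_mult[OF sA])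
  also have "\<dots> = (\<Sum>j. lam (Suc j) * (?\<kappa> * ?A j - ?E j))"
    by (simp add: algebra_simps)
  also have "\<dots> \<le> (\<Sum>j. lam (Suc j) * (psi (spin_val Plus * avg j ?z) - psi (spin_val Plus * avg j ?z')))"
  proof (rule suminf_le)
    show "lam (Suc j) * (?\<kappa> * ?A j - ?E j) \<le>
        lam (Suc j) * (psi (spin_val Plus * avg j ?z) - psi (spin_val Plus * avg j ?z'))" for j
      using psi_avg_diff_ge[OF r0 c u w, of j] lam_pos[of j] by (intro mult_left_mono) simp_all
    show "summable (\<lambda>j. lam (Suc j) * (?\<kappa> * ?A j - ?E j))"
      using summable_diff[OF summable_mult[OF sA, of ?\<kappa>] sE] by (simp add: algebra_simps)
    show "summable (\<lambda>j. lam (Suc j) * (psi (spin_val Plus * avg j ?z) - psi (spin_val Plus * avg j ?z')))"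
      by (intro summable_lam_bounded abs_psi_diff)
  qed
  finally show ?thesis
    by (simp only: kernel_diff)
qed

theorem dynamic_uniqueness_iff:
  assumes "lacunary m psi"
  shows "dynamic_uniqueness (bkf_kernel m lam psi) \<longleftrightarrow> l2_criterion (bkf_kernel m lam psi)"
proof
  assume "l2_criterion (bkf_kernel m lam psi)"
  then show "dynamic_uniqueness (bkf_kernel m lam psi)"
    using is_prob_kernel eps_pos eps_le_kernel by (intro l2_criterion_imp_dynamic_uniqueness)
next
  obtain r0 where r0: "0 \<le> r0" "r0 < 1" "psi (- r0) < psi r0"
    using assms by (auto simp: lacunary_def)
  \<comment> \<open>This size forces the averages over windows longer than
    \<open>c * (k + n)\<close> past \<open>r0\<close> and \<open>- r0\<close> respectively.\<close>
  obtain c :: nat where "2 / (1 - r0) < real c"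
    using reals_Archimedean2 by blast
  then have c: "2 \<le> real c * (1 - r0)"
    using r0 by (simp add: field_simps)
  then have "0 < c"
    by (cases c) auto
  assume "dynamic_uniqueness (bkf_kernel m lam psi)"
  then show "l2_criterion (bkf_kernel m lam psi)"
  proof (rule contrapos_pp)
    assume "\<not> l2_criterion (bkf_kernel m lam psi)"
    then have div: "\<not> summable (\<lambda>k. (weight_above k)\<^sup>2)"
      using l2_criterionI[OF is_prob_kernel variation_le_weight_above] by blast
    show "\<not> dynamic_uniqueness (bkf_kernel m lam psi)"
    proof (rule not_dynamic_uniquenessI[OF is_prob_kernel])
      fix n w w' assume w: "w \<in> words n" "w' \<in> words n"
      show "(\<lambda>i. affinity (bkf_kernel m lam psi) i (concat_past w (\<lambda>_. Plus)) (concat_past w' (\<lambda>_. Minus))) \<longlonglongrightarrow> 0"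
      proof (rule affinity_tendsto_0[OF is_prob_kernel kernel_diff_ge[OF r0 c _ w]])
        show "0 \<le> (psi r0 - psi (- r0)) * weight_above (c * (k + n))" for k
          using r0 weight_above_nonneg by simp
        \<comment> \<open>The lower bound sees \<open>weight_above\<close> only along multiples of
          \<open>c\<close>; monotonicity preserves the divergence.\<close>
        have "\<not> summable (\<lambda>k. (weight_above (c * (k + n)))\<^sup>2)"
          using div summable_power2_subsampled[OF antimono_weight_above weight_above_nonneg \<open>0 < c\<close>] by blast
        then show "\<not> summable (\<lambda>k. ((psi r0 - psi (- r0)) * weight_above (c * (k + n)))\<^sup>2)"
          using r0 by (simp add: power_mult_distrib summable_cmult_iff)
        show "summable (\<lambda>k. (\<Sum>j. lam (Suc j) * of_bool (k < m (Suc j) \<and> m (Suc j) < k + 2 * n))\<^sup>2)"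
          using lam_pos
          by (intro summable_power2_nonneg summable_weight_window suminf_nonneg summable_lam_bounded)
            (auto intro: less_imp_le)
      qed
    qed
  qed
qed

end

subsection \<open>Autoregressive kernels\<close>

locale autoreg =
  fixes phi beta delta K
  assumes model: "autoreg_model phi beta" and attr: "attractive beta delta"
    and K: "1 \<le> K"
    and lip: "\<And>r s. \<lbrakk>\<bar>r\<bar> \<le> autoreg_radius beta delta; \<bar>s\<bar> \<le> autoreg_radius beta delta\<rbrakk> \<Longrightarrow>
      inverse K * \<bar>r - s\<bar> \<le> \<bar>phi r - phi s\<bar> \<and> \<bar>phi r - phi s\<bar> \<le> K * \<bar>r - s\<bar>"
begin

definition local_field :: "past \<Rightarrow> real" where
  "local_field z = (\<Sum>n. beta (Suc n) * spin_val (z n)) + delta"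

text \<open>Half the largest possible change of \<open>local_field\<close> between pasts that agree
  on their first \<open>q\<close> positions.\<close>

definition tail_weight :: "nat \<Rightarrow> real" where
  "tail_weight q = (\<Sum>i. beta (Suc (i + q)))"

lemma is_prob_kernel: "prob_kernel (autoreg_kernel phi beta delta)"
  using model by (rule prob_kernel_autoreg)

lemma beta_nonneg: "0 \<le> beta (Suc n)"
  using attr by (simp add: attractive_def)

lemma summable_beta: "summable (\<lambda>n. beta (Suc n))"
  using model beta_nonneg by (simp add: autoreg_model_def)

lemma summable_beta_shift: "summable (\<lambda>n. beta (Suc (n + q)))"
  using summable_beta summable_iff_shift[of "\<lambda>n. beta (Suc n)" q] by simp

lemma summable_local_field: "summable (\<lambda>n. beta (Suc n) * spin_val (z n))"
  using beta_nonneg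
  by (intro summable_comparison_test'[OF summable_beta, where N=0]) (auto simp: abs_mult)

lemma kernel_eq: "autoreg_kernel phi beta delta a z = phi (spin_val a * local_field z)"
  by (simp add: autoreg_kernel_def local_field_def distrib_left)

text \<open>Every argument at which the kernel evaluates \<open>phi\<close> thus lies where the
  bi-Lipschitz bounds hold.\<close>

lemma abs_local_field: "\<bar>local_field z\<bar> \<le> autoreg_radius beta delta"
proof -
  have "norm (\<Sum>n. beta (Suc n) * spin_val (z n)) \<le> (\<Sum>n. \<bar>beta (Suc n)\<bar>)"
    using summable_beta beta_nonneg by (intro norm_suminf_le) (auto simp: abs_mult)
  then show ?thesis
    unfolding local_field_def autoreg_radius_def real_norm_def by linarith
qed

lemma abs_spin_local_field: "\<bar>spin_val a * local_field z\<bar> \<le> autoreg_radius beta delta"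
  using abs_local_field by (simp add: abs_mult)

lemma strict_mono_phi: "strict_mono phi"
  using model by (simp add: autoreg_model_def)

lemma kernel_ge: "phi (- autoreg_radius beta delta) \<le> autoreg_kernel phi beta delta a z"
proof -
  have "- autoreg_radius beta delta \<le> spin_val a * local_field z"
    using abs_spin_local_field[of a z] by (simp add: abs_le_iff)
  then show ?thesis
    unfolding kernel_eq by (rule monoD[OF strict_mono_mono[OF strict_mono_phi]])
qed

lemma phi_pos: "0 < phi r"
  using model by (auto simp: autoreg_model_def subset_iff)

lemma local_field_diff: "local_field z - local_field z' = (\<Sum>n. beta (Suc n) * (spin_val (z n) - spin_val (z' n)))"
  by (simp add: local_field_def suminf_diff[OF summable_local_field summable_local_field] right_diff_distrib)

lemma summable_local_field_diff: "summable (\<lambda>n. beta (Suc n) * (spin_val (z n) - spin_val (z' n)))"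
  using summable_diff[OF summable_local_field summable_local_field] by (simp add: right_diff_distrib)

lemma tail_weight_nonneg: "0 \<le> tail_weight q"
  unfolding tail_weight_def by (intro suminf_nonneg summable_beta_shift beta_nonneg)

text \<open>Only positions beyond the common word differ, each moving the field by at most twice its
  coefficient; the upper Lipschitz bound carries this over to the kernel.\<close>

lemma variation_le_tail_weight: "variation k (autoreg_kernel phi beta delta) \<le> 2 * K * tail_weight k"
proof (rule variation_le)
  fix a :: spin and w :: "spin list" and x y :: past assume w: "length w = k"
  let ?z = "concat_past w x" and ?z' = "concat_past w y"
  let ?h = "\<lambda>n. beta (Suc n) * (spin_val (?z n) - spin_val (?z' n))"
  have "(\<Sum>i<k. ?h i) = 0"
    using concat_past_agree[of w k _ x y] w by (intro sum.neutral) (simp add: words_def)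
  then have "local_field ?z - local_field ?z' = (\<Sum>n. ?h (n + k))"
    unfolding local_field_diff using suminf_split_initial_segment[OF summable_local_field_diff, of ?z ?z' k] by simp
  also have "\<bar>\<dots>\<bar> \<le> (\<Sum>n. 2 * beta (Suc (n + k)))"
  proof -
    have "norm (?h (n + k)) \<le> 2 * beta (Suc (n + k))" for n
    proof -
      have "\<bar>spin_val (?z (n + k)) - spin_val (?z' (n + k))\<bar> \<le> 2"
        using spin_val_bounds[of "?z (n + k)"] spin_val_bounds[of "?z' (n + k)"] by linarith
      from mult_left_mono[OF this beta_nonneg[of "n + k"]] show ?thesis
        using beta_nonneg[of "n + k"] by (simp add: abs_mult mult.commute)
    qed
    then show ?thesis
      using norm_suminf_le[of "\<lambda>n. ?h (n + k)" "\<lambda>n. 2 * beta (Suc (n + k))"]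
      by (simp add: summable_mult summable_beta_shift)
  qed
  also have "\<dots> = 2 * tail_weight k"
    by (simp add: tail_weight_def suminf_mult summable_beta_shift)
  finally have le: "\<bar>local_field ?z - local_field ?z'\<bar> \<le> 2 * tail_weight k" .
  have "\<bar>spin_val a * local_field ?z - spin_val a * local_field ?z'\<bar> = \<bar>local_field ?z - local_field ?z'\<bar>"
    by (simp add: right_diff_distrib[symmetric] abs_mult)
  then have "\<bar>autoreg_kernel phi beta delta a ?z - autoreg_kernel phi beta delta a ?z'\<bar> \<le>
      K * \<bar>local_field ?z - local_field ?z'\<bar>"
    using lip[OF abs_spin_local_field abs_spin_local_field, of a ?z a ?z'] by (simp add: kernel_eq)
  also have "\<dots> \<le> K * (2 * tail_weight k)"
    using le K by (intro mult_left_mono) auto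
  finally show "\<bar>autoreg_kernel phi beta delta a ?z - autoreg_kernel phi beta delta a ?z'\<bar> \<le>
      2 * K * tail_weight k"
    by (simp add: mult_ac)
qed

text \<open>As the coefficients are nonnegative, the constant pasts raise the field difference by
  twice the tail weight, while the \<open>n\<close> positions of \<open>w\<close> and
  \<open>w'\<close> lower it by at most twice their coefficients.\<close>

lemma kernel_diff_ge:
  assumes u: "u \<in> words k" and w: "w \<in> words n" "w' \<in> words n"
  shows "2 / K * tail_weight (k + n) - 2 * K * (\<Sum>i<n. beta (Suc (k + i)))
    \<le> autoreg_kernel phi beta delta Plus (concat_past u (concat_past w (\<lambda>_. Plus))) -
      autoreg_kernel phi beta delta Plus (concat_past u (concat_past w' (\<lambda>_. Minus)))"
proof -
  let ?z = "concat_past u (concat_past w (\<lambda>_. Plus))"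
  let ?z' = "concat_past u (concat_past w' (\<lambda>_. Minus))"
  let ?h = "\<lambda>i. beta (Suc i) * (spin_val (?z i) - spin_val (?z' i))"
  let ?r = "local_field ?z" and ?s = "local_field ?z'"
  define T where "T = tail_weight (k + n)"
  define b where "b = (\<Sum>i<n. beta (Suc (k + i)))"
  have T: "0 \<le> T"
    by (simp add: T_def tail_weight_nonneg)
  have b: "0 \<le> b"
    unfolding b_def by (intro sum_nonneg beta_nonneg)
  have "?r - ?s = (\<Sum>i. ?h (i + (k + n))) + (\<Sum>i<k + n. ?h i)"
    unfolding local_field_diff by (rule suminf_split_initial_segment[OF summable_local_field_diff])
  also have "(\<Sum>i. ?h (i + (k + n))) = (\<Sum>i. 2 * beta (Suc (i + (k + n))))"
    using concat_past_const[OF u w(1)] concat_past_const[OF u w(2)]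
    by (intro suminf_cong) simp
  also have "\<dots> = 2 * T"
    unfolding T_def tail_weight_def by (rule suminf_mult[OF summable_beta_shift])
  also have "(\<Sum>i<k + n. ?h i) = (\<Sum>i<k. ?h i) + (\<Sum>i<n. ?h (k + i))"
    by (induction n) auto
  also have "(\<Sum>i<k. ?h i) = 0"
    by (intro sum.neutral ballI) (metis concat_past_agree[OF u] diff_self mult_zero_right lessThan_iff)
  finally have "?r - ?s = 2 * T + (\<Sum>i<n. ?h (k + i))"
    by simp
  moreover have "(\<Sum>i<n. - 2 * beta (Suc (k + i))) \<le> (\<Sum>i<n. ?h (k + i))"
  proof (rule sum_mono)
    fix i
    have "- 2 \<le> spin_val (?z (k + i)) - spin_val (?z' (k + i))"
      using spin_val_bounds(1)[of "?z (k + i)"] spin_val_bounds(2)[of "?z' (k + i)"] by linarith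
    from mult_left_mono[OF this beta_nonneg[of "k + i"]]
    show "- 2 * beta (Suc (k + i)) \<le> ?h (k + i)"
      by (simp add: mult.commute)
  qed
  moreover have "(\<Sum>i<n. - 2 * beta (Suc (k + i))) = - 2 * b"
    unfolding b_def by (rule sum_distrib_left[symmetric])
  ultimately have rs: "2 * T - 2 * b \<le> ?r - ?s"
    by linarith
  have KK: "T / K \<le> K * T" "b / K \<le> K * b"
  proof -
    have "c / K \<le> K * c" if "0 \<le> c" for c
    proof -
      have "c / K \<le> c"
        using that K mult_right_mono[OF K that] by (simp add: field_simps)
      also have "\<dots> \<le> K * c"
        using mult_right_mono[OF K that] by simp
      finally show ?thesis .
    qed
    then show "T / K \<le> K * T" "b / K \<le> K * b"
      using T b by auto
  qed
  note lip' = lip[OF abs_local_field abs_local_field, of ?z ?z']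
  \<comment> \<open>The fields may be ordered either way. In the expected order the lower Lipschitz
    bound secures the gain, otherwise the upper one limits the loss; \<open>KK\<close> reconciles
    the constants.\<close>
  have "2 * (T / K) - 2 * (K * b) \<le> phi ?r - phi ?s"
  proof (cases "?s \<le> ?r")
    case True
    then have "phi ?s \<le> phi ?r"
      by (rule monoD[OF strict_mono_mono[OF strict_mono_phi]])
    have "(2 * T - 2 * b) / K \<le> (?r - ?s) / K"
      using rs K by (intro divide_right_mono) auto
    also have "\<dots> \<le> phi ?r - phi ?s"
      using lip' True \<open>phi ?s \<le> phi ?r\<close> by (simp add: divide_inverse mult.commute)
    finally show ?thesis
      using KK(2) by (simp add: diff_divide_distrib)
  next
    case False
    then have "phi ?r \<le> phi ?s"
      by (intro monoD[OF strict_mono_mono[OF strict_mono_phi]]) simp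
    then have "phi ?s - phi ?r \<le> K * (?s - ?r)"
      using lip' False by simp
    also have "\<dots> \<le> K * (2 * b - 2 * T)"
      using rs K by (intro mult_left_mono) auto
    also have "\<dots> = 2 * (K * b) - 2 * (K * T)"
      by (simp add: right_diff_distrib)
    finally show ?thesis
      using KK(1) by linarith
  qed
  then show ?thesis
    by (simp add: kernel_eq T_def b_def mult_ac)
qed

theorem dynamic_uniqueness_iff:
  "dynamic_uniqueness (autoreg_kernel phi beta delta) \<longleftrightarrow> l2_criterion (autoreg_kernel phi beta delta)"
proof
  assume "l2_criterion (autoreg_kernel phi beta delta)"
  then show "dynamic_uniqueness (autoreg_kernel phi beta delta)"
    using is_prob_kernel phi_pos kernel_ge by (intro l2_criterion_imp_dynamic_uniqueness)
next
  assume "dynamic_uniqueness (autoreg_kernel phi beta delta)"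
  then show "l2_criterion (autoreg_kernel phi beta delta)"
  proof (rule contrapos_pp)
    assume "\<not> l2_criterion (autoreg_kernel phi beta delta)"
    then have "\<not> summable (\<lambda>k. (2 * K * tail_weight k)\<^sup>2)"
      using l2_criterionI[OF is_prob_kernel variation_le_tail_weight] by blast
    then have div: "\<not> summable (\<lambda>k. (tail_weight k)\<^sup>2)"
      using K by (simp add: power_mult_distrib summable_cmult_iff)
    show "\<not> dynamic_uniqueness (autoreg_kernel phi beta delta)"
    proof (rule not_dynamic_uniquenessI[OF is_prob_kernel])
      fix n w w' assume w: "w \<in> words n" "w' \<in> words n"
      show "(\<lambda>i. affinity (autoreg_kernel phi beta delta) i (concat_past w (\<lambda>_. Plus))
          (concat_past w' (\<lambda>_. Minus))) \<longlonglongrightarrow> 0"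
      proof (rule affinity_tendsto_0[OF is_prob_kernel kernel_diff_ge[OF _ w]])
        show "0 \<le> 2 / K * tail_weight (k + n)" for k
          using K tail_weight_nonneg by simp
        have "\<not> summable (\<lambda>k. (tail_weight (k + n))\<^sup>2)"
          using div summable_iff_shift[of "\<lambda>k. (tail_weight k)\<^sup>2" n] by simp
        then show "\<not> summable (\<lambda>k. (2 / K * tail_weight (k + n))\<^sup>2)"
          using K by (simp only: power_mult_distrib summable_cmult_iff) simp
        \<comment> \<open>For fixed \<open>n\<close> the error is a finite sum of shifts of a
          summable nonnegative sequence, hence square-summable.\<close>
        have "summable (\<lambda>k. beta (Suc (k + i)))" for i
          by (rule summable_beta_shift)
        then show "summable (\<lambda>k. (2 * K * (\<Sum>i<n. beta (Suc (k + i))))\<^sup>2)"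
          using K beta_nonneg
          by (intro summable_power2_nonneg summable_mult summable_sum mult_nonneg_nonneg sum_nonneg) auto
      qed
    qed
  qed
qed

end

theorem corollary3:
  fixes g :: "spin \<Rightarrow> past \<Rightarrow> real"
  assumes "(\<exists>eps m lam psi. bkf_model eps m lam psi \<and> lacunary m psi \<and> g = bkf_kernel m lam psi) \<or>
    (\<exists>phi beta delta. autoreg_model phi beta \<and> attractive beta delta \<and>
       bi_lipschitz_on {- autoreg_radius beta delta..autoreg_radius beta delta} phi \<and>
       g = autoreg_kernel phi beta delta)"
  shows "dynamic_uniqueness g \<longleftrightarrow> l2_criterion g"
  using assms
proof
  assume "\<exists>eps m lam psi. bkf_model eps m lam psi \<and> lacunary m psi \<and> g = bkf_kernel m lam psi"
  then obtain eps m lam psi where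
    "bkf_model eps m lam psi" "lacunary m psi" "g = bkf_kernel m lam psi"
    by blast
  then show ?thesis
    using bkf.dynamic_uniqueness_iff[OF bkf.intro] by blast
next
  assume "\<exists>phi beta delta. autoreg_model phi beta \<and> attractive beta delta \<and>
       bi_lipschitz_on {- autoreg_radius beta delta..autoreg_radius beta delta} phi \<and>
       g = autoreg_kernel phi beta delta"
  then obtain phi beta delta where model: "autoreg_model phi beta" "attractive beta delta"
    and lip: "bi_lipschitz_on {- autoreg_radius beta delta..autoreg_radius beta delta} phi"
    and g: "g = autoreg_kernel phi beta delta"
    by blast
  from lip obtain K where "1 \<le> K"
    "\<forall>r\<in>{- autoreg_radius beta delta..autoreg_radius beta delta}.
      \<forall>s\<in>{- autoreg_radius beta delta..autoreg_radius beta delta}.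
       inverse K * \<bar>r - s\<bar> \<le> \<bar>phi r - phi s\<bar> \<and> \<bar>phi r - phi s\<bar> \<le> K * \<bar>r - s\<bar>"
    unfolding bi_lipschitz_on_def by blast
  then interpret autoreg phi beta delta K
    using model by unfold_locales (auto simp: abs_le_iff)
  show ?thesis
    unfolding g by (rule dynamic_uniqueness_iff)
qed

end
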